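(* Let $H\in(0,1)$ and $K\in(0,2)$ be such that $0<HK<1$. Let $\{W_\theta,\theta\ge 0\}$ be a standard Brownian motion and let $X^{H,K}=\{X^{H,K}_t\}_{t\ge 0}$ be (a continuous version of) the centered Gaussian process given by $X^{H,K}_0=0$ and $$X^{H,K}_t=\int_0^\infty \bigl(1-e^{-\theta t^{2H}}\bigr)\,\theta^{-\frac{1+K}{2}}\,dW_\theta,\qquad t>0 .$$ Then, almost surely, the path $t\mapsto X^{H,K}_t$ restricted to $I=(0,1)$ belongs to the Besov-Orlicz space $\mathcal{B}^{HK}_{\Phi_2,\infty}(I)$.
   Context: The integral defining $X^{H,K}_t$ is a Wiener integral of a deterministic square-integrable function with respect to $W$. Besov-Orlicz space: let $I=(0,1)$ and, for $h\in\mathbb{R}$, $I(h)=\{s\in I: s+h\in I\}$. For an interval $J\subseteq I$ and a measurable $f:J\to\mathbb{R}$ put $\|f\|_{L^{\Phi_2}(J)}=\sup_{p\ge 1}p^{-1/2}\|f\|_{L^p(J)}$, the supremum being over real $p\ge1$ (this is the exponential Orlicz norm associated with $\Phi_2(x)=e^{x^2}-1$). For $\alpha\in(0,1)$, $\mathcal{B}^{\alpha}_{\Phi_2,\infty}(I)$ is the space of measurable $f$ on $I$ with $\|f\|_{L^{\Phi_2}(I)}<\infty$ and $$\sup_{0<t\le 1}t^{-\alpha}\sup_{|h|\le t}\|f(\cdot+h)-f(\cdot)\|_{L^{\Phi_2}(I(h))}<\infty .$$ This last seminorm is equivalent to $\sup_{n\ge 1}2^{n\alpha}\|f(\cdot+2^{-n})-f(\cdot)\|_{L^{\Phi_2}(I(2^{-n}))}$,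 and the norm used on the space is $\|f\|_{L^{\Phi_2}(I)}+\sup_{n\ge1}2^{n\alpha}\|f(\cdot+2^{-n})-f(\cdot)\|_{L^{\Phi_2}(I(2^{-n}))}$. *)

theory Defs
  imports "HOL-Probability.Probability"
begin

definition standard_brownian_motion :: "'a measure \<Rightarrow> (real \<Rightarrow> 'a \<Rightarrow> real) \<Rightarrow> bool" where
  "standard_brownian_motion M W \<longleftrightarrow>
     prob_space M \<and>
     (\<forall>t\<ge>0. W t \<in> borel_measurable M) \<and>
     (AE \<omega> in M. W 0 \<omega> = 0) \<and>
     (\<forall>(n::nat) (t :: nat \<Rightarrow> real). 0 \<le> t 0 \<longrightarrow> (\<forall>i<n. t i < t (Suc i)) \<longrightarrow>
        prob_space.indep_vars M (\<lambda>_. borel) (\<lambda>i \<omega>. W (t (Suc i)) \<omega> - W (t i) \<omega>) {..<n}) \<and>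
     (\<forall>s t. 0 \<le> s \<longrightarrow> s < t \<longrightarrow>
        distributed M lborel (\<lambda>\<omega>. W t \<omega> - W s \<omega>) (normal_density 0 (sqrt (t - s)))) \<and>
     (AE \<omega> in M. continuous_on {0..} (\<lambda>t. W t \<omega>))"

definition step_fun :: "nat \<Rightarrow> (nat \<Rightarrow> real) \<Rightarrow> (nat \<Rightarrow> real) \<Rightarrow> real \<Rightarrow> real" where
  "step_fun n t c x = (\<Sum>i<n. c i * indicator {t i<..t (Suc i)} x)"

definition step_integral ::
  "(real \<Rightarrow> 'a \<Rightarrow> real) \<Rightarrow> nat \<Rightarrow> (nat \<Rightarrow> real) \<Rightarrow> (nat \<Rightarrow> real) \<Rightarrow> 'a \<Rightarrow> real" where
  "step_integral W n t c \<omega> = (\<Sum>i<n. c i * (W (t (Suc i)) \<omega> - W (t i) \<omega>))"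

text \<open>The Wiener integral of a square-integrable \<open>f\<close> over \<open>[0,\<infinity>)\<close> is the \<open>L\<^sup>2(M)\<close>-limit of the
  integrals of step functions converging to \<open>f\<close> in \<open>L\<^sup>2([0,\<infinity>))\<close>. By the isometry the limit does not
  depend on the approximating sequence, and it is determined only up to almost sure equality; hence
  a predicate, ``\<open>Z\<close> is a version of the integral of \<open>f\<close>''.\<close>

definition is_wiener_integral ::
  "'a measure \<Rightarrow> (real \<Rightarrow> 'a \<Rightarrow> real) \<Rightarrow> (real \<Rightarrow> real) \<Rightarrow> ('a \<Rightarrow> real) \<Rightarrow> bool" where
  "is_wiener_integral M W f Z \<longleftrightarrow>
     set_borel_measurable lborel {0..} f \<and>
     set_integrable lborel {0..} (\<lambda>x. (f x)\<^sup>2) \<and>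
     Z \<in> borel_measurable M \<and>
     (\<exists>n t c.
        (\<forall>k::nat. 0 \<le> t k 0 \<and> (\<forall>i<n k. t k i < t k (Suc i))) \<and>
        (\<lambda>k. \<integral>\<^sup>+x\<in>{0..}. ennreal ((f x - step_fun (n k) (t k) (c k) x)\<^sup>2) \<partial>lborel)
           \<longlonglongrightarrow> 0 \<and>
        (\<lambda>k. \<integral>\<^sup>+\<omega>. ennreal ((Z \<omega> - step_integral W (n k) (t k) (c k) \<omega>)\<^sup>2) \<partial>M)
           \<longlonglongrightarrow> 0)"

definition XHK_kernel :: "real \<Rightarrow> real \<Rightarrow> real \<Rightarrow> real \<Rightarrow> real" where
  "XHK_kernel H K t \<theta> = (1 - exp (- \<theta> * t powr (2 * H))) * \<theta> powr (- ((1 + K) / 2))"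

text \<open>A continuous version: for each fixed \<open>t\<close> the variable \<open>X t\<close> is only required to agree almost
  surely with the integral.\<close>

definition continuous_version_XHK ::
  "'a measure \<Rightarrow> (real \<Rightarrow> 'a \<Rightarrow> real) \<Rightarrow> real \<Rightarrow> real \<Rightarrow> (real \<Rightarrow> 'a \<Rightarrow> real) \<Rightarrow> bool" where
  "continuous_version_XHK M W H K X \<longleftrightarrow>
     X 0 \<in> borel_measurable M \<and>
     (AE \<omega> in M. X 0 \<omega> = 0) \<and>
     (\<forall>t>0. is_wiener_integral M W (XHK_kernel H K t) (X t)) \<and>
     (AE \<omega> in M. continuous_on {0..} (\<lambda>t. X t \<omega>))"

text \<open>All norms take values in \<open>[0,\<infinity>]\<close>; \<open>enn2real\<close> and \<open>powr\<close> are used only on finite values.\<close>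

definition Lp_norm_on :: "real \<Rightarrow> real set \<Rightarrow> (real \<Rightarrow> real) \<Rightarrow> ennreal" where
  "Lp_norm_on p J f =
     (let S = \<integral>\<^sup>+x\<in>J. ennreal (\<bar>f x\<bar> powr p) \<partial>lebesgue
      in if S = \<infinity> then \<infinity> else ennreal (enn2real S powr (1 / p)))"

definition orlicz_norm_on :: "real set \<Rightarrow> (real \<Rightarrow> real) \<Rightarrow> ennreal" where
  "orlicz_norm_on J f = (SUP p\<in>{1..}. ennreal (p powr (- 1 / 2)) * Lp_norm_on p J f)"

definition unit_I :: "real set" where
  "unit_I = {0<..<1}"

definition shift_I :: "real \<Rightarrow> real set" where
  "shift_I h = {s \<in> unit_I. s + h \<in> unit_I}"

definition besov_orlicz_seminorm :: "real \<Rightarrow> (real \<Rightarrow> real) \<Rightarrow> ennreal" where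
  "besov_orlicz_seminorm \<alpha> f =
     (SUP t\<in>{0<..1}. ennreal (t powr (- \<alpha>)) *
        (SUP h\<in>{h. \<bar>h\<bar> \<le> t}. orlicz_norm_on (shift_I h) (\<lambda>s. f (s + h) - f s)))"

text \<open>Functions on \<open>unit_I\<close> are represented by functions on the whole line; membership depends only
  on their values on \<open>unit_I\<close>.\<close>

definition besov_orlicz :: "real \<Rightarrow> (real \<Rightarrow> real) set" where
  "besov_orlicz \<alpha> =
     {f. f \<in> borel_measurable (lebesgue_on unit_I) \<and>
         orlicz_norm_on unit_I f < \<infinity> \<and>
         besov_orlicz_seminorm \<alpha> f < \<infinity>}"

end

theory Submission
  imports Defs
begin

text \<open>
  Write \<open>\<alpha> = HK\<close>. The process is smooth away from \<open>0\<close>, and the exponent \<open>\<alpha>\<close> is forced only by its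
  self-similarity at the origin. So the whole question is how fast the increments
  deteriorate near \<open>0\<close>, and a logarithmic loss there is harmless: the weight
  \<open>L(s) = (1 + ln (1/s))\<^sup>1\<^sup>/\<^sup>2\<close> satisfies \<open>L(s)\<^sup>p \<le> p\<^sup>p\<^sup>/\<^sup>2 s\<^sup>-\<^sup>1\<^sup>/\<^sup>2\<close>, so its \<open>L\<^sup>p\<close> norm on \<open>(0,1)\<close> is at most
  \<open>2 p\<^sup>1\<^sup>/\<^sup>2\<close> and its exponential Orlicz norm is finite (\<open>orlicz_norm_log_weight\<close>). Consequently it is
  enough to find a random constant \<open>D\<close> with
  \<open>\<bar>X(s + h) - X(s)\<bar> \<le> D h\<^sup>\<alpha> L(s)\<close> and \<open>\<bar>X(s)\<bar> \<le> D s\<^sup>\<alpha> L(s)\<close>; this is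
  \<open>log_modulus_imp_besov_orlicz\<close>.

  The variances come from two elementary facts about the kernel \<open>k\<^sub>t\<close>. By substitution,
  \<open>\<parallel>k\<^sub>t\<parallel>\<^sup>2 = t\<^sup>2\<^sup>\<alpha> \<parallel>k\<^sub>1\<parallel>\<^sup>2\<close> (\<open>XHK_kernel_scaling\<close>). By \<open>x e\<^sup>-\<^sup>x \<le> 1 - e\<^sup>-\<^sup>x\<close>, one has the pointwise bound
  \<open>\<bar>k\<^sub>s\<^sub>+\<^sub>h - k\<^sub>s\<bar> \<le> 5 (h/s) k\<^sub>s\<close> for \<open>h \<le> 3s\<close> (\<open>XHK_kernel_increment\<close>). So \<open>X(s + h) - X(s)\<close> has standard
  deviation at most a multiple of \<open>(h/s) s\<^sup>\<alpha>\<close>: the increments are Lipschitz in quadratic mean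
  at distance \<open>s\<close> from the origin.

  These variances become tail bounds because step integrals of Brownian motion have Gaussian exponential
  moments, and Gaussian tails survive the \<open>L\<^sup>2\<close> limit up to the constant in the exponent
  (\<open>wiener_integral_difference_tail\<close>). The Borel--Cantelli lemma then controls simultaneously all dyadic
  increments of level \<open>n\<close> in all blocks \<open>[2\<^sup>-\<^sup>k\<^sup>-\<^sup>1, 4 \<cdot> 2\<^sup>-\<^sup>k\<^sup>-\<^sup>1]\<close>, at the price of a factor \<open>(k + n + 1)\<^sup>1\<^sup>/\<^sup>2\<close>
  (\<open>AE_log_bound_of_subgaussian_families\<close>). Since \<open>\<alpha> < 1\<close>, the dependence on \<open>n\<close> is absorbed when the Lipschitz
  scale \<open>2\<^sup>-\<^sup>n\<close> is relaxed to \<open>2\<^sup>-\<^sup>n\<^sup>\<alpha>\<close>, and chaining gives an \<open>\<alpha>\<close>-Hoelder bound on the block with constant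
  of order \<open>(k + 1)\<^sup>1\<^sup>/\<^sup>2\<close> (\<open>dyadic_bounds_imp_log_modulus\<close>), which is \<open>L(s)\<close> up to a constant for \<open>s\<close> in the block.
\<close>

section \<open>Step integrals of Brownian motion\<close>

lemma partition_nonneg:
  fixes t :: "nat \<Rightarrow> real"
  assumes "0 \<le> t 0" "\<And>i. i < n \<Longrightarrow> t i < t (Suc i)" "i \<le> n"
  shows "0 \<le> t i"
  using assms(3)
  by (induction i) (use assms(1,2) in \<open>auto intro: order.trans less_imp_le simp: Suc_le_eq\<close>)

lemma normal_mgf:
  assumes "distributed M lborel Y (normal_density 0 s)" "0 < s"
  shows "(\<integral>\<^sup>+\<omega>. ennreal (exp (l * Y \<omega>)) \<partial>M) = ennreal (exp (l\<^sup>2 * s\<^sup>2 / 2))"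
proof -
  \<comment> \<open>Completing the square turns the exponential weight into a shift of the mean to \<open>l s\<^sup>2\<close>.\<close>
  have sq: "- (x\<^sup>2) / (2 * s\<^sup>2) + l * x = l\<^sup>2 * s\<^sup>2 / 2 - (x - l * s\<^sup>2)\<^sup>2 / (2 * s\<^sup>2)" for x
    using assms(2) by (simp add: field_simps power2_eq_square)
  have "(\<integral>\<^sup>+\<omega>. ennreal (exp (l * Y \<omega>)) \<partial>M)
      = (\<integral>\<^sup>+x. ennreal (normal_density 0 s x) * ennreal (exp (l * x)) \<partial>lborel)"
    by (rule distributed_nn_integral[OF assms(1), symmetric]) simp
  also have "\<dots> = (\<integral>\<^sup>+x. ennreal (exp (l\<^sup>2 * s\<^sup>2 / 2)) * ennreal (normal_density (l * s\<^sup>2) s x) \<partial>lborel)"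
    using sq by (intro nn_integral_cong)
      (simp add: normal_density_def mult_exp_exp flip: ennreal_mult)
  also have "\<dots> = ennreal (exp (l\<^sup>2 * s\<^sup>2 / 2)) * 1"
    using assms(2) by (subst nn_integral_cmult)
      (auto simp: nn_integral_eq_integral integrable_normal_density integral_normal_density)
  finally show ?thesis by simp
qed

lemma step_integral_mgf:
  assumes W: "standard_brownian_motion M W" and t: "0 \<le> t 0" "\<And>i. i < n \<Longrightarrow> t i < t (Suc i)"
  shows "(\<integral>\<^sup>+\<omega>. ennreal (exp (l * step_integral W n t c \<omega>)) \<partial>M)
    = ennreal (exp (l\<^sup>2 / 2 * (\<Sum>i<n. (c i)\<^sup>2 * (t (Suc i) - t i))))"
proof -
  interpret prob_space M using W by (simp add: standard_brownian_motion_def)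
  have t_nonneg: "0 \<le> t i" if "i \<le> n" for i
    using partition_nonneg[OF t that] .
  have "indep_vars (\<lambda>_. borel) (\<lambda>i \<omega>. W (t (Suc i)) \<omega> - W (t i) \<omega>) {..<n}"
    using W t by (auto simp: standard_brownian_motion_def)
  then have ind: "indep_vars (\<lambda>_. borel)
      (\<lambda>i \<omega>. ennreal (exp (l * c i * (W (t (Suc i)) \<omega> - W (t i) \<omega>)))) {..<n}"
    by (rule indep_vars_compose2[where Y = "\<lambda>i x. ennreal (exp (l * c i * x))"]) simp
  have single: "(\<integral>\<^sup>+\<omega>. ennreal (exp (l * c i * (W (t (Suc i)) \<omega> - W (t i) \<omega>))) \<partial>M)
      = ennreal (exp (l\<^sup>2 / 2 * ((c i)\<^sup>2 * (t (Suc i) - t i))))" if "i < n" for i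
  proof -
    have "distributed M lborel (\<lambda>\<omega>. W (t (Suc i)) \<omega> - W (t i) \<omega>) (normal_density 0 (sqrt (t (Suc i) - t i)))"
      using W t_nonneg[of i] t(2)[of i] that by (auto simp: standard_brownian_motion_def)
    from normal_mgf[OF this, of "l * c i"] show ?thesis
      using t(2)[OF that] by (simp add: power_mult_distrib mult_ac)
  qed
  have "(\<integral>\<^sup>+\<omega>. ennreal (exp (l * step_integral W n t c \<omega>)) \<partial>M)
     = (\<integral>\<^sup>+\<omega>. (\<Prod>i<n. ennreal (exp (l * c i * (W (t (Suc i)) \<omega> - W (t i) \<omega>)))) \<partial>M)"
    by (simp add: step_integral_def sum_distrib_left exp_sum prod_ennreal mult_ac)
  also have "\<dots> = (\<Prod>i<n. \<integral>\<^sup>+\<omega>. ennreal (exp (l * c i * (W (t (Suc i)) \<omega> - W (t i) \<omega>))) \<partial>M)"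
    using ind by (intro indep_vars_nn_integral) auto
  also have "\<dots> = (\<Prod>i<n. ennreal (exp (l\<^sup>2 / 2 * ((c i)\<^sup>2 * (t (Suc i) - t i)))))"
    using single by (intro prod.cong) auto
  also have "\<dots> = ennreal (exp (l\<^sup>2 / 2 * (\<Sum>i<n. (c i)\<^sup>2 * (t (Suc i) - t i))))"
    by (simp add: sum_distrib_left exp_sum prod_ennreal)
  finally show ?thesis .
qed

lemma step_fun_borel [measurable]: "step_fun n t c \<in> borel_measurable borel"
  unfolding step_fun_def[abs_def] by measurable

lemma step_integral_borel:
  assumes W: "standard_brownian_motion M W" and t: "0 \<le> t 0" "\<And>i. i < n \<Longrightarrow> t i < t (Suc i)"
  shows "step_integral W n t c \<in> borel_measurable M"
proof -
  have t_nonneg: "0 \<le> t i" if "i \<le> n" for i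
    using partition_nonneg[OF t that] .
  show ?thesis unfolding step_integral_def[abs_def]
    using W t_nonneg
    by (intro borel_measurable_sum borel_measurable_times borel_measurable_diff borel_measurable_const)
      (auto simp: standard_brownian_motion_def)
qed

lemma step_fun_square:
  assumes "\<And>i. i < n \<Longrightarrow> t i < t (Suc i)"
  shows "(step_fun n t c x)\<^sup>2 = (\<Sum>i<n. (c i)\<^sup>2 * indicator {t i<..t (Suc i)} x)"
  using assms
proof (induction n)
  case 0
  then show ?case by (simp add: step_fun_def)
next
  case (Suc n)
  have mono: "t i \<le> t n" if "i \<le> n" for i
    using that Suc.prems by (induction n) (force simp: le_Suc_eq less_Suc_eq)+
  have "step_fun n t c x * indicator {t n<..t (Suc n)} x = 0"
    unfolding step_fun_def sum_distrib_right
  proof (rule sum.neutral, rule ballI)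
    fix i assume "i \<in> {..<n}"
    then show "c i * indicator {t i<..t (Suc i)} x * indicator {t n<..t (Suc n)} x = 0"
      using mono[of "Suc i"] by (auto simp: indicator_def)
  qed
  moreover have "step_fun (Suc n) t c x = step_fun n t c x + c n * indicator {t n<..t (Suc n)} x"
    by (simp add: step_fun_def)
  ultimately show ?case
    using Suc by (auto simp: power2_sum indicator_def)
qed

lemma step_fun_L2:
  assumes "0 \<le> t 0" "\<And>i. i < n \<Longrightarrow> t i < t (Suc i)"
  shows "(\<integral>\<^sup>+x\<in>{0..}. ennreal ((step_fun n t c x)\<^sup>2) \<partial>lborel)
    = ennreal (\<Sum>i<n. (c i)\<^sup>2 * (t (Suc i) - t i))"
proof -
  have t_nonneg: "0 \<le> t i" if "i \<le> n" for i
    using partition_nonneg[OF assms that] .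
  have "(\<integral>\<^sup>+x\<in>{0..}. ennreal ((step_fun n t c x)\<^sup>2) \<partial>lborel)
      = (\<integral>\<^sup>+x. (\<Sum>i<n. ennreal ((c i)\<^sup>2) * indicator {t i<..t (Suc i)} x) \<partial>lborel)"
  proof (rule nn_integral_cong)
    fix x :: real
    have "ennreal ((step_fun n t c x)\<^sup>2) = (\<Sum>i<n. ennreal ((c i)\<^sup>2) * indicator {t i<..t (Suc i)} x)"
      using assms(2) by (simp add: step_fun_square ennreal_mult ennreal_indicator flip: sum_ennreal)
    moreover have "(\<Sum>i<n. ennreal ((c i)\<^sup>2) * indicator {t i<..t (Suc i)} x) = 0" if "x < 0"
    proof (rule sum.neutral, rule ballI)
      fix i assume "i \<in> {..<n}"
      then show "ennreal ((c i)\<^sup>2) * indicator {t i<..t (Suc i)} x = 0"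
        using t_nonneg[of i] that by (auto simp: indicator_def)
    qed
    ultimately show "ennreal ((step_fun n t c x)\<^sup>2) * indicator {0..} x
        = (\<Sum>i<n. ennreal ((c i)\<^sup>2) * indicator {t i<..t (Suc i)} x)"
      by (cases "x < 0") (auto simp: indicator_def)
  qed
  also have "\<dots> = (\<Sum>i<n. ennreal ((c i)\<^sup>2 * (t (Suc i) - t i)))"
    using assms(2) by (subst nn_integral_sum)
      (auto intro!: sum.cong simp: nn_integral_cmult ennreal_mult less_imp_le simp del: sum_ennreal)
  also have "\<dots> = ennreal (\<Sum>i<n. (c i)\<^sup>2 * (t (Suc i) - t i))"
    using assms(2) by (intro sum_ennreal) (auto simp: less_imp_le)
  finally show ?thesis .
qed

text \<open>A single telescoping identity serves twice below. With \<open>G\<close> a path of \<open>W\<close> it refines the increments of \<open>W\<close>;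
  with \<open>G\<close> the step \<open>y \<mapsto> [x \<le> y]\<close> it refines the indicator of a half-open interval, evaluated at \<open>x\<close>.\<close>

lemma telescope_on_refinement:
  fixes u :: "nat \<Rightarrow> real" and G :: "real \<Rightarrow> real"
  assumes u: "\<And>i j. i < j \<Longrightarrow> j \<le> N \<Longrightarrow> u i < u j"
    and "a \<in> u ` {..N}" "b \<in> u ` {..N}" "a < b"
  shows "(\<Sum>j<N. indicator {a<..b} (u (Suc j)) * (G (u (Suc j)) - G (u j))) = G b - G a"
proof -
  obtain p q where p: "p \<le> N" "a = u p" and q: "q \<le> N" "b = u q" using assms by auto
  have mono: "u i \<le> u j \<longleftrightarrow> i \<le> j" "u i < u j \<longleftrightarrow> i < j" if "i \<le> N" "j \<le> N" for i j
    using u that by (metis linorder_not_less nle_le order.strict_iff_order)+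
  have "p < q" using mono p q assms by auto
  have "(\<Sum>j<N. indicator {a<..b} (u (Suc j)) * (G (u (Suc j)) - G (u j)))
      = (\<Sum>j\<in>{p..<q}. G (u (Suc j)) - G (u j))"
    by (rule sum.mono_neutral_cong_right)
      (use mono p q in \<open>auto simp: indicator_def less_Suc_eq_le Suc_le_eq\<close>)
  also have "\<dots> = G b - G a"
    using sum_Suc_diff'[of p q "\<lambda>j. G (u j)"] \<open>p < q\<close> p q by simp
  finally show ?thesis .
qed

text \<open>On the cells of a finer partition the step function is constant, so its value at the right end point is the
  coefficient there.\<close>

lemma step_on_refinement:
  assumes u: "\<And>i j. i < j \<Longrightarrow> j \<le> N \<Longrightarrow> u i < u j"
    and t: "\<And>i. i \<le> n \<Longrightarrow> t i \<in> u ` {..N}" "\<And>i. i < n \<Longrightarrow> t i < t (Suc i)"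
  shows "step_fun n t c x = step_fun N u (\<lambda>j. step_fun n t c (u (Suc j))) x"
    and "step_integral W n t c \<omega> = step_integral W N u (\<lambda>j. step_fun n t c (u (Suc j))) \<omega>"
proof -
  have key: "(\<Sum>i<n. c i * (G (t (Suc i)) - G (t i)))
      = (\<Sum>j<N. step_fun n t c (u (Suc j)) * (G (u (Suc j)) - G (u j)))" for G :: "real \<Rightarrow> real"
  proof -
    have "(\<Sum>i<n. c i * (G (t (Suc i)) - G (t i)))
      = (\<Sum>i<n. c i * (\<Sum>j<N. indicator {t i<..t (Suc i)} (u (Suc j)) * (G (u (Suc j)) - G (u j))))"
      by (intro sum.cong refl arg_cong2[of _ _ _ _ "(*)"] telescope_on_refinement[symmetric] u t) auto
    also have "\<dots> = (\<Sum>j<N. step_fun n t c (u (Suc j)) * (G (u (Suc j)) - G (u j)))"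
      unfolding sum_distrib_left step_fun_def sum_distrib_right
      by (subst sum.swap) (simp add: mult_ac)
    finally show ?thesis .
  qed
  have ind: "indicator {a<..b} x = of_bool (x \<le> b) - (of_bool (x \<le> a) :: real)" if "a < b" for a b :: real
    using that by (auto simp: indicator_def)
  show "step_fun n t c x = step_fun N u (\<lambda>j. step_fun n t c (u (Suc j))) x"
    using key[of "\<lambda>y. of_bool (x \<le> y)"] ind t(2) u
    by (simp add: step_fun_def[of n t c x] step_fun_def[of N u _ x] Suc_le_eq)
  show "step_integral W n t c \<omega> = step_integral W N u (\<lambda>j. step_fun n t c (u (Suc j))) \<omega>"
    using key[of "\<lambda>y. W y \<omega>"] by (simp add: step_integral_def)
qed

text \<open>The two integrals to be compared come with unrelated partitions. On the common refinement, their difference is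
  again one step integral, to which the independence of the increments applies.\<close>

lemma step_difference:
  assumes t: "0 \<le> t 0" "\<And>i. i < n \<Longrightarrow> t i < t (Suc i)"
    and t': "0 \<le> t' 0" "\<And>i. i < n' \<Longrightarrow> t' i < t' (Suc i)"
  obtains N u d where "0 \<le> u 0" "\<And>i. i < N \<Longrightarrow> u i < u (Suc i)"
    "\<And>x. step_fun n t c x - step_fun n' t' c' x = step_fun N u d x"
    "\<And>\<omega>. step_integral W n t c \<omega> - step_integral W n' t' c' \<omega> = step_integral W N u d \<omega>"
proof -
  define P where "P = t ` {..n} \<union> t' ` {..n'}"
  define l where "l = sorted_list_of_set P"
  define N where "N = length l - 1"
  define u where "u i = l ! i" for i
  have fin: "finite P" and ne: "P \<noteq> {}" by (auto simp: P_def)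
  have l: "set l = P" "sorted_wrt (<) l" "l \<noteq> []"
    using fin ne by (auto simp: l_def)
  have len: "length l = Suc N" using l(3) by (simp add: N_def)
  have u: "u i < u j" if "i < j" "j \<le> N" for i j
    using sorted_wrt_nth_less[OF l(2)] that len by (simp add: u_def)
  have img: "u ` {..N} = P"
    unfolding l(1)[symmetric] set_conv_nth len u_def by auto
  have nonneg: "0 \<le> x" if "x \<in> P" for x
  proof -
    have "0 \<le> t i" if "i \<le> n" for i using partition_nonneg[OF t that] .
    moreover have "0 \<le> t' i" if "i \<le> n'" for i using partition_nonneg[OF t' that] .
    ultimately show ?thesis using that by (auto simp: P_def)
  qed
  have "0 \<le> u 0" using nonneg img by auto
  let ?d = "\<lambda>j. step_fun n t c (u (Suc j))" and ?d' = "\<lambda>j. step_fun n' t' c' (u (Suc j))"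
  have eq: "step_fun n t c x = step_fun N u ?d x"
      "step_integral W n t c \<omega> = step_integral W N u ?d \<omega>" for x \<omega>
    by (rule step_on_refinement; use u t img in \<open>auto simp: P_def\<close>)+
  have eq': "step_fun n' t' c' x = step_fun N u ?d' x"
      "step_integral W n' t' c' \<omega> = step_integral W N u ?d' \<omega>" for x \<omega>
    by (rule step_on_refinement; use u t' img in \<open>auto simp: P_def\<close>)+
  show ?thesis
  proof (rule that[of u N "\<lambda>j. ?d j - ?d' j"])
    show "step_fun n t c x - step_fun n' t' c' x = step_fun N u (\<lambda>j. ?d j - ?d' j) x" for x
      by (subst eq(1), subst eq'(1)) (simp add: step_fun_def[of N] left_diff_distrib sum_subtractf)
    show "step_integral W n t c \<omega> - step_integral W n' t' c' \<omega> = step_integral W N u (\<lambda>j. ?d j - ?d' j) \<omega>" for \<omega>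
      by (subst eq(2), subst eq'(2)) (simp add: step_integral_def[of _ N] left_diff_distrib sum_subtractf)
  qed (use u \<open>0 \<le> u 0\<close> in auto)
qed


section \<open>Gaussian tails of Wiener integrals\<close>

text \<open>Chernoff's bound, with the optimal parameter \<open>r / v\<close> in the exponential moment.\<close>

lemma step_integral_upper_tail:
  assumes W: "standard_brownian_motion M W" and t: "0 \<le> t 0" "\<And>i. i < n \<Longrightarrow> t i < t (Suc i)"
    and L2: "(\<integral>\<^sup>+x\<in>{0..}. ennreal ((step_fun n t c x)\<^sup>2) \<partial>lborel) \<le> ennreal v" and "0 < v" "0 < r"
  shows "emeasure M {\<omega> \<in> space M. r \<le> step_integral W n t c \<omega>} \<le> ennreal (exp (- (r\<^sup>2 / (2 * v))))"
proof -
  define Q where "Q = (\<Sum>i<n. (c i)\<^sup>2 * (t (Suc i) - t i))"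
  have "Q \<le> v"
    using L2 \<open>0 < v\<close> by (simp add: step_fun_L2[where c = c, OF t] Q_def)
  have [measurable]: "step_integral W n t c \<in> borel_measurable M"
    by (rule step_integral_borel[OF W t])
  have "emeasure M {\<omega> \<in> space M. r \<le> step_integral W n t c \<omega>}
      \<le> ennreal (exp (- (r / v) * r))
        * (\<integral>\<^sup>+\<omega>. ennreal (exp (r / v * step_integral W n t c \<omega>)) * indicator (space M) \<omega> \<partial>M)"
    using \<open>0 < v\<close> \<open>0 < r\<close> by (intro Chernoff_ineq_nn_integral_ge) auto
  also have "(\<integral>\<^sup>+\<omega>. ennreal (exp (r / v * step_integral W n t c \<omega>)) * indicator (space M) \<omega> \<partial>M)
      = (\<integral>\<^sup>+\<omega>. ennreal (exp (r / v * step_integral W n t c \<omega>)) \<partial>M)"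
    by (rule nn_integral_cong) simp
  also have "\<dots> = ennreal (exp ((r / v)\<^sup>2 / 2 * Q))"
    unfolding Q_def by (rule step_integral_mgf[OF W t])
  also have "ennreal (exp (- (r / v) * r)) * ennreal (exp ((r / v)\<^sup>2 / 2 * Q))
      \<le> ennreal (exp (- (r / v) * r)) * ennreal (exp ((r / v)\<^sup>2 / 2 * v))"
    using \<open>Q \<le> v\<close> by (intro mult_left_mono ennreal_leI) (auto intro!: mult_left_mono)
  also have "\<dots> = ennreal (exp (- (r\<^sup>2 / (2 * v))))"
    using \<open>0 < v\<close> by (simp add: mult_exp_exp field_simps power2_eq_square flip: ennreal_mult)
  finally show ?thesis .
qed

lemma step_integral_tail:
  assumes W: "standard_brownian_motion M W" and t: "0 \<le> t 0" "\<And>i. i < n \<Longrightarrow> t i < t (Suc i)"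
    and L2: "(\<integral>\<^sup>+x\<in>{0..}. ennreal ((step_fun n t c x)\<^sup>2) \<partial>lborel) \<le> ennreal v" and v: "0 < v" "0 < r"
  shows "emeasure M {\<omega> \<in> space M. r \<le> \<bar>step_integral W n t c \<omega>\<bar>}
    \<le> ennreal (2 * exp (- (r\<^sup>2 / (2 * v))))"
proof -
  have neg: "step_integral W n t (\<lambda>i. - c i) \<omega> = - step_integral W n t c \<omega>"
      "step_fun n t (\<lambda>i. - c i) x = - step_fun n t c x" for \<omega> x
    by (simp_all add: step_integral_def step_fun_def sum_negf)
  have [measurable]: "step_integral W n t c \<in> borel_measurable M"
    by (rule step_integral_borel[OF W t])
  have "emeasure M {\<omega> \<in> space M. r \<le> \<bar>step_integral W n t c \<omega>\<bar>}
     = emeasure M ({\<omega> \<in> space M. r \<le> step_integral W n t c \<omega>}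
         \<union> {\<omega> \<in> space M. r \<le> step_integral W n t (\<lambda>i. - c i) \<omega>})"
    by (rule arg_cong[where f = "emeasure M"]) (auto simp: neg)
  also have "\<dots> \<le> emeasure M {\<omega> \<in> space M. r \<le> step_integral W n t c \<omega>}
      + emeasure M {\<omega> \<in> space M. r \<le> step_integral W n t (\<lambda>i. - c i) \<omega>}"
    by (rule emeasure_subadditive) (auto simp: neg)
  also have "\<dots> \<le> ennreal (exp (- (r\<^sup>2 / (2 * v)))) + ennreal (exp (- (r\<^sup>2 / (2 * v))))"
    using L2 by (intro add_mono step_integral_upper_tail W t v) (simp_all add: neg)
  also have "\<dots> = ennreal (2 * exp (- (r\<^sup>2 / (2 * v))))"
    by (simp flip: ennreal_plus)
  finally show ?thesis .
qed

lemma second_moment_tail: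
  fixes Y :: "'a \<Rightarrow> real"
  assumes [measurable]: "Y \<in> borel_measurable M" and "0 < r"
  shows "emeasure M {\<omega> \<in> space M. r \<le> \<bar>Y \<omega>\<bar>} \<le> ennreal (1 / r\<^sup>2) * (\<integral>\<^sup>+\<omega>. ennreal ((Y \<omega>)\<^sup>2) \<partial>M)"
proof -
  have "{\<omega> \<in> space M. r \<le> \<bar>Y \<omega>\<bar>} = {\<omega> \<in> space M. 1 \<le> ennreal (1 / r\<^sup>2) * ennreal ((Y \<omega>)\<^sup>2)}"
    using \<open>0 < r\<close> abs_le_square_iff[of r] by (auto simp: field_simps simp flip: ennreal_mult)
  then show ?thesis
    using nn_integral_Markov_inequality[of "\<lambda>\<omega>. ennreal ((Y \<omega>)\<^sup>2)" "space M" M "ennreal (1 / r\<^sup>2)"]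
    by (simp cong: nn_integral_cong)
qed

lemma square_sum3_le: "(a + b + c)\<^sup>2 \<le> 3 * (a\<^sup>2 + b\<^sup>2 + c\<^sup>2 :: real)"
proof -
  have "0 \<le> (a - b)\<^sup>2 + (b - c)\<^sup>2 + (a - c)\<^sup>2" by simp
  then show ?thesis by (simp add: power2_eq_square algebra_simps)
qed

lemma L2_triangle:
  fixes f g s s' :: "real \<Rightarrow> real"
  assumes f: "set_borel_measurable lborel {0..} f" and g: "set_borel_measurable lborel {0..} g"
    and [measurable]: "s \<in> borel_measurable borel" "s' \<in> borel_measurable borel"
  shows "(\<integral>\<^sup>+x\<in>{0..}. ennreal ((s x - s' x)\<^sup>2) \<partial>lborel)
    \<le> 3 * ((\<integral>\<^sup>+x\<in>{0..}. ennreal ((f x - s x)\<^sup>2) \<partial>lborel)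
         + (\<integral>\<^sup>+x\<in>{0..}. ennreal ((f x - g x)\<^sup>2) \<partial>lborel)
         + (\<integral>\<^sup>+x\<in>{0..}. ennreal ((g x - s' x)\<^sup>2) \<partial>lborel))"
proof -
  \<comment> \<open>Measurability is known on the half-line only, hence the extension by zero.\<close>
  define f' g' :: "real \<Rightarrow> real" where "f' x = indicator {0..} x * f x" and "g' x = indicator {0..} x * g x" for x
  have [measurable]: "f' \<in> borel_measurable borel" "g' \<in> borel_measurable borel"
    using f g by (simp_all add: set_borel_measurable_def f'_def[abs_def] g'_def[abs_def])
  have eq: "(\<integral>\<^sup>+x\<in>{0..}. ennreal ((f x - s x)\<^sup>2) \<partial>lborel) = (\<integral>\<^sup>+x\<in>{0..}. ennreal ((f' x - s x)\<^sup>2) \<partial>lborel)"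
    "(\<integral>\<^sup>+x\<in>{0..}. ennreal ((g x - s' x)\<^sup>2) \<partial>lborel) = (\<integral>\<^sup>+x\<in>{0..}. ennreal ((g' x - s' x)\<^sup>2) \<partial>lborel)"
    "(\<integral>\<^sup>+x\<in>{0..}. ennreal ((f x - g x)\<^sup>2) \<partial>lborel) = (\<integral>\<^sup>+x\<in>{0..}. ennreal ((f' x - g' x)\<^sup>2) \<partial>lborel)"
    by (auto intro!: nn_integral_cong simp: f'_def g'_def indicator_def)
  have "(\<integral>\<^sup>+x\<in>{0..}. ennreal ((s x - s' x)\<^sup>2) \<partial>lborel)
    \<le> (\<integral>\<^sup>+x. 3 * (ennreal ((f' x - s x)\<^sup>2) * indicator {0..} x
        + ennreal ((f' x - g' x)\<^sup>2) * indicator {0..} x + ennreal ((g' x - s' x)\<^sup>2) * indicator {0..} x) \<partial>lborel)"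
  proof (rule nn_integral_mono)
    fix x :: real
    have "(s x - s' x)\<^sup>2 \<le> 3 * ((f' x - s x)\<^sup>2 + (f' x - g' x)\<^sup>2 + (g' x - s' x)\<^sup>2)"
      using square_sum3_le[of "s x - f' x" "f' x - g' x" "g' x - s' x"]
      by (simp add: power2_commute[of "s x" "f' x"])
    then have "ennreal ((s x - s' x)\<^sup>2) \<le> ennreal (3 * ((f' x - s x)\<^sup>2 + (f' x - g' x)\<^sup>2 + (g' x - s' x)\<^sup>2))"
      by (rule ennreal_leI)
    also have "\<dots> = 3 * (ennreal ((f' x - s x)\<^sup>2) + ennreal ((f' x - g' x)\<^sup>2) + ennreal ((g' x - s' x)\<^sup>2))"
      by (simp add: ennreal_mult)
    finally show "ennreal ((s x - s' x)\<^sup>2) * indicator {0..} x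
      \<le> 3 * (ennreal ((f' x - s x)\<^sup>2) * indicator {0..} x
        + ennreal ((f' x - g' x)\<^sup>2) * indicator {0..} x + ennreal ((g' x - s' x)\<^sup>2) * indicator {0..} x)"
      by (auto simp: indicator_def)
  qed
  also have "\<dots> = 3 * ((\<integral>\<^sup>+x\<in>{0..}. ennreal ((f x - s x)\<^sup>2) \<partial>lborel)
         + (\<integral>\<^sup>+x\<in>{0..}. ennreal ((f x - g x)\<^sup>2) \<partial>lborel)
         + (\<integral>\<^sup>+x\<in>{0..}. ennreal ((g x - s' x)\<^sup>2) \<partial>lborel))"
    unfolding eq by (simp add: nn_integral_cmult nn_integral_add)
  finally show ?thesis .
qed

text \<open>The step integrals \<open>S\<^sub>k\<close>, \<open>S'\<^sub>k\<close> approximating \<open>Z\<close>, \<open>Z'\<close> have differences whose variances are eventually at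
  most \<open>4v\<close>, so Chernoff's bound controls \<open>\<bar>S\<^sub>k - S'\<^sub>k\<bar> \<ge> r/2\<close> uniformly in \<open>k\<close>. The probability that \<open>Z\<close> or \<open>Z'\<close>
  differs from its approximation by \<open>r/4\<close> tends to \<open>0\<close> by Chebyshev's inequality. Splitting \<open>r\<close> and enlarging
  \<open>v\<close> in this way turns the constant \<open>2\<close> of Chernoff's bound into \<open>32\<close>.\<close>

lemma wiener_integral_difference_tail:
  assumes W: "standard_brownian_motion M W"
    and Z: "is_wiener_integral M W f Z" and Z': "is_wiener_integral M W g Z'"
    and fg: "(\<integral>\<^sup>+x\<in>{0..}. ennreal ((f x - g x)\<^sup>2) \<partial>lborel) \<le> ennreal v" and "0 < v" "0 < r"
  shows "emeasure M {\<omega> \<in> space M. r \<le> \<bar>Z \<omega> - Z' \<omega>\<bar>} \<le> ennreal (2 * exp (- (r\<^sup>2 / (32 * v))))"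
proof -
  have [measurable]: "Z \<in> borel_measurable M" "Z' \<in> borel_measurable M"
    and f: "set_borel_measurable lborel {0..} f" and g: "set_borel_measurable lborel {0..} g"
    using Z Z' by (auto simp: is_wiener_integral_def)
  obtain n t c where t: "\<And>k. 0 \<le> t k 0" "\<And>k i. i < n k \<Longrightarrow> t k i < t k (Suc i)"
    and s_lim: "(\<lambda>k::nat. \<integral>\<^sup>+x\<in>{0..}. ennreal ((f x - step_fun (n k) (t k) (c k) x)\<^sup>2) \<partial>lborel) \<longlonglongrightarrow> 0"
    and S_lim: "(\<lambda>k. \<integral>\<^sup>+\<omega>. ennreal ((Z \<omega> - step_integral W (n k) (t k) (c k) \<omega>)\<^sup>2) \<partial>M) \<longlonglongrightarrow> 0"
    using Z unfolding is_wiener_integral_def by blast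
  obtain n' t' c' where t': "\<And>k. 0 \<le> t' k 0" "\<And>k i. i < n' k \<Longrightarrow> t' k i < t' k (Suc i)"
    and s'_lim: "(\<lambda>k::nat. \<integral>\<^sup>+x\<in>{0..}. ennreal ((g x - step_fun (n' k) (t' k) (c' k) x)\<^sup>2) \<partial>lborel) \<longlonglongrightarrow> 0"
    and S'_lim: "(\<lambda>k. \<integral>\<^sup>+\<omega>. ennreal ((Z' \<omega> - step_integral W (n' k) (t' k) (c' k) \<omega>)\<^sup>2) \<partial>M) \<longlonglongrightarrow> 0"
    using Z' unfolding is_wiener_integral_def by blast
  define S S' where "S k = step_integral W (n k) (t k) (c k)" and "S' k = step_integral W (n' k) (t' k) (c' k)" for k
  define e e' where "e k = (\<integral>\<^sup>+\<omega>. ennreal ((Z \<omega> - S k \<omega>)\<^sup>2) \<partial>M)" and "e' k = (\<integral>\<^sup>+\<omega>. ennreal ((Z' \<omega> - S' k \<omega>)\<^sup>2) \<partial>M)" for k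
  have [measurable]: "S k \<in> borel_measurable M" "S' k \<in> borel_measurable M" for k
    unfolding S_def S'_def
    by (rule step_integral_borel[OF W t(1)[of k] t(2)[of _ k]], assumption)
      (rule step_integral_borel[OF W t'(1)[of k] t'(2)[of _ k]], assumption)
  define E where "E = ennreal (2 * exp (- (r\<^sup>2 / (32 * v))))"
  have "\<forall>\<^sub>F k in sequentially. emeasure M {\<omega> \<in> space M. r \<le> \<bar>Z \<omega> - Z' \<omega>\<bar>}
      \<le> E + (ennreal (1 / (r/4)\<^sup>2) * e k + ennreal (1 / (r/4)\<^sup>2) * e' k)"
  proof -
    have "\<forall>\<^sub>F k in sequentially. (\<integral>\<^sup>+x\<in>{0..}. ennreal ((f x - step_fun (n k) (t k) (c k) x)\<^sup>2) \<partial>lborel) < ennreal (v / 6)"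
      "\<forall>\<^sub>F k in sequentially. (\<integral>\<^sup>+x\<in>{0..}. ennreal ((g x - step_fun (n' k) (t' k) (c' k) x)\<^sup>2) \<partial>lborel) < ennreal (v / 6)"
      using \<open>0 < v\<close> by (auto intro!: order_tendstoD(2)[OF s_lim] order_tendstoD(2)[OF s'_lim])
    then show ?thesis
    proof eventually_elim
      case (elim k)
      obtain N u d where u: "0 \<le> u 0" "\<And>i. i < N \<Longrightarrow> u i < u (Suc i)"
        and d: "\<And>x. step_fun (n k) (t k) (c k) x - step_fun (n' k) (t' k) (c' k) x = step_fun N u d x"
        and D: "\<And>\<omega>. S k \<omega> - S' k \<omega> = step_integral W N u d \<omega>"
        unfolding S_def S'_def
        using step_difference[OF t(1)[of k] t(2)[of _ k] t'(1)[of k] t'(2)[of _ k], where c = "c k" and c' = "c' k" and W = W]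
        by metis
      have "(\<integral>\<^sup>+x\<in>{0..}. ennreal ((step_fun N u d x)\<^sup>2) \<partial>lborel)
          \<le> 3 * (ennreal (v / 6) + ennreal v + ennreal (v / 6))"
        unfolding d[symmetric]
        by (rule order.trans[OF L2_triangle[OF f g]])
          (use elim fg in \<open>auto intro!: mult_left_mono add_mono simp: less_imp_le\<close>)
      also have "\<dots> = ennreal (4 * v)"
        using \<open>0 < v\<close> by (simp flip: ennreal_plus ennreal_mult ennreal_numeral)
      finally have "emeasure M {\<omega> \<in> space M. r / 2 \<le> \<bar>step_integral W N u d \<omega>\<bar>}
          \<le> ennreal (2 * exp (- ((r / 2)\<^sup>2 / (2 * (4 * v)))))"
        using \<open>0 < v\<close> \<open>0 < r\<close> by (intro step_integral_tail[OF W u]) auto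
      also have "\<dots> = E" by (simp add: E_def power_divide)
      finally have main: "emeasure M {\<omega> \<in> space M. r / 2 \<le> \<bar>S k \<omega> - S' k \<omega>\<bar>} \<le> E"
        by (simp add: D)
      have "emeasure M {\<omega> \<in> space M. r \<le> \<bar>Z \<omega> - Z' \<omega>\<bar>}
        \<le> emeasure M ({\<omega> \<in> space M. r / 2 \<le> \<bar>S k \<omega> - S' k \<omega>\<bar>}
            \<union> ({\<omega> \<in> space M. r / 4 \<le> \<bar>Z \<omega> - S k \<omega>\<bar>} \<union> {\<omega> \<in> space M. r / 4 \<le> \<bar>Z' \<omega> - S' k \<omega>\<bar>}))"
      proof (rule emeasure_mono, rule subsetI)
        fix \<omega> assume \<omega>: "\<omega> \<in> {\<omega> \<in> space M. r \<le> \<bar>Z \<omega> - Z' \<omega>\<bar>}"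
        then have "r \<le> \<bar>Z \<omega> - Z' \<omega>\<bar>" by simp
        then have "r / 2 \<le> \<bar>S k \<omega> - S' k \<omega>\<bar> \<or> r / 4 \<le> \<bar>Z \<omega> - S k \<omega>\<bar> \<or> r / 4 \<le> \<bar>Z' \<omega> - S' k \<omega>\<bar>"
          by linarith
        with \<omega> show "\<omega> \<in> {\<omega> \<in> space M. r / 2 \<le> \<bar>S k \<omega> - S' k \<omega>\<bar>}
            \<union> ({\<omega> \<in> space M. r / 4 \<le> \<bar>Z \<omega> - S k \<omega>\<bar>} \<union> {\<omega> \<in> space M. r / 4 \<le> \<bar>Z' \<omega> - S' k \<omega>\<bar>})"
          by blast
      qed simp
      also have "\<dots> \<le> emeasure M {\<omega> \<in> space M. r / 2 \<le> \<bar>S k \<omega> - S' k \<omega>\<bar>}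
            + emeasure M ({\<omega> \<in> space M. r / 4 \<le> \<bar>Z \<omega> - S k \<omega>\<bar>} \<union> {\<omega> \<in> space M. r / 4 \<le> \<bar>Z' \<omega> - S' k \<omega>\<bar>})"
        by (rule emeasure_subadditive) auto
      also have "\<dots> \<le> E + (emeasure M {\<omega> \<in> space M. r / 4 \<le> \<bar>Z \<omega> - S k \<omega>\<bar>}
            + emeasure M {\<omega> \<in> space M. r / 4 \<le> \<bar>Z' \<omega> - S' k \<omega>\<bar>})"
        by (intro add_mono main emeasure_subadditive) auto
      also have "\<dots> \<le> E + (ennreal (1 / (r/4)\<^sup>2) * e k + ennreal (1 / (r/4)\<^sup>2) * e' k)"
        unfolding e_def e'_def using \<open>0 < r\<close> by (intro add_mono order.refl second_moment_tail) auto
      finally show ?case .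
    qed
  qed
  moreover have "(\<lambda>k. E + (ennreal (1 / (r/4)\<^sup>2) * e k + ennreal (1 / (r/4)\<^sup>2) * e' k))
      \<longlonglongrightarrow> E + (ennreal (1 / (r/4)\<^sup>2) * 0 + ennreal (1 / (r/4)\<^sup>2) * 0)"
    using S_lim S'_lim by (intro tendsto_intros ennreal_tendsto_cmult) (auto simp: e_def e'_def S_def S'_def)
  ultimately show ?thesis
    unfolding E_def[symmetric] by (intro tendsto_lowerbound) auto
qed

text \<open>The empty partition shows that \<open>0\<close> is an integral of \<open>0\<close>, so that the tail of a single integral is the special
  case \<open>g = 0\<close>, \<open>Z' = 0\<close> of the bound on differences.\<close>

lemma wiener_integral_zero: "is_wiener_integral M W (\<lambda>_. 0) (\<lambda>_. 0)"
  unfolding is_wiener_integral_def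
  by (auto simp: set_borel_measurable_def set_integrable_def step_fun_def step_integral_def
      intro!: exI[of _ "\<lambda>_. 0"])

section \<open>A uniform bound for exponentially growing families\<close>

text \<open>A union bound over \<open>8\<^sup>m\<^sup>+\<^sup>1\<close> variables costs a factor that the Gaussian tail at the height
  \<open>R (m + 1)\<^sup>1\<^sup>/\<^sup>2\<close> beats as soon as \<open>R\<^sup>2 / b > ln 8\<close>; the Borel--Cantelli lemma then leaves finitely many exceptional
  families, which are absorbed into the random constant.\<close>

lemma AE_log_bound_of_subgaussian_families:
  fixes \<xi> :: "nat \<Rightarrow> 'i \<Rightarrow> 'a \<Rightarrow> real"
  assumes "prob_space M" and fin: "\<And>m. finite (I m)" and card: "\<And>m. card (I m) \<le> 8 ^ Suc m"
    and meas: "\<And>m i. i \<in> I m \<Longrightarrow> \<xi> m i \<in> borel_measurable M"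
    and tail: "\<And>m i r. i \<in> I m \<Longrightarrow> 0 < r \<Longrightarrow>
      emeasure M {\<omega> \<in> space M. r \<le> \<bar>\<xi> m i \<omega>\<bar>} \<le> ennreal (2 * exp (- (r\<^sup>2 / b)))"
    and "0 < b"
  shows "AE \<omega> in M. \<exists>C\<ge>0. \<forall>m. \<forall>i\<in>I m. \<bar>\<xi> m i \<omega>\<bar> \<le> C * sqrt (real (Suc m))"
proof -
  interpret prob_space M by fact
  \<comment> \<open>This \<open>R\<close> makes the tail at height \<open>R (m + 1)\<^sup>1\<^sup>/\<^sup>2\<close> equal to \<open>2 \<cdot> 16\<^sup>-\<^sup>m\<^sup>-\<^sup>1\<close>, which leaves \<open>2\<^sup>-\<^sup>m\<close> after the union bound.\<close>
  define R where "R = sqrt (b * ln 16)"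
  have "0 < R" using \<open>0 < b\<close> by (simp add: R_def)
  define A where "A m = (\<Union>i\<in>I m. {\<omega> \<in> space M. R * sqrt (real (Suc m)) \<le> \<bar>\<xi> m i \<omega>\<bar>})" for m
  have A_sets: "A m \<in> sets M" for m
    unfolding A_def using meas fin by (intro sets.finite_UN) (auto intro!: borel_measurable_le)
  have A_bound: "emeasure M (A m) \<le> ennreal ((1 / 2) ^ m)" for m
  proof -
    have exp_eq: "exp (- ((R * sqrt (real (Suc m)))\<^sup>2 / b)) = (1 / 16) ^ Suc m"
    proof -
      have "(R * sqrt (real (Suc m)))\<^sup>2 / b = real (Suc m) * ln 16"
        using \<open>0 < b\<close> by (simp add: R_def power_mult_distrib)
      then show ?thesis
        by (simp add: exp_minus exp_of_nat_mult power_one_over inverse_eq_divide del: power_Suc of_nat_Suc)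
    qed
    have "emeasure M (A m) \<le> (\<Sum>i\<in>I m. emeasure M {\<omega> \<in> space M. R * sqrt (real (Suc m)) \<le> \<bar>\<xi> m i \<omega>\<bar>})"
      unfolding A_def using fin meas by (intro emeasure_subadditive_finite) (auto intro!: borel_measurable_le)
    also have "\<dots> \<le> (\<Sum>i\<in>I m. ennreal (2 * (1 / 16) ^ Suc m))"
      using tail[of _ m "R * sqrt (real (Suc m))"] \<open>0 < R\<close> unfolding exp_eq
      by (intro sum_mono) auto
    also have "\<dots> = ennreal (real (card (I m)) * (2 * (1 / 16) ^ Suc m))"
      by (simp add: ennreal_mult ennreal_of_nat_eq_real_of_nat del: power_Suc)
    also have "\<dots> \<le> ennreal (8 ^ Suc m * (2 * (1 / 16) ^ Suc m))"
      using card[of m] by (intro ennreal_leI mult_right_mono) (auto simp del: power_Suc simp flip: of_nat_le_iff)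
    also have "8 ^ Suc m * (2 * (1 / 16) ^ Suc m) = (1 / 2 :: real) ^ m"
      by (simp add: power_divide flip: power_mult_distrib) (simp add: power_mult_distrib[symmetric] field_simps)
    finally show ?thesis .
  qed
  have "AE \<omega> in M. \<forall>\<^sub>F m in sequentially. \<omega> \<in> space M - A m"
  proof (rule borel_cantelli_AE1)
    show "summable (\<lambda>m. measure M (A m))"
    proof (rule summable_comparison_test_ev)
      show "\<forall>\<^sub>F m in sequentially. norm (measure M (A m)) \<le> (1 / 2) ^ m"
        using A_bound by (auto simp: emeasure_eq_measure)
    qed (rule summable_geometric, simp)
  qed (use A_sets in \<open>auto simp: emeasure_eq_measure\<close>)
  then show ?thesis
  proof (eventually_elim)
    case (elim \<omega>)
    then obtain m0 where m0: "\<And>m. m0 \<le> m \<Longrightarrow> \<omega> \<in> space M - A m"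
      by (auto simp: eventually_sequentially)
    define F where "F = (\<lambda>(m, i). \<bar>\<xi> m i \<omega>\<bar>) ` (SIGMA m:{..<m0}. I m)"
    have "finite F" unfolding F_def using fin by auto
    define C where "C = Max (insert R F)"
    have C: "R \<le> C" "\<And>y. y \<in> F \<Longrightarrow> y \<le> C" using \<open>finite F\<close> by (auto simp: C_def)
    have "\<bar>\<xi> m i \<omega>\<bar> \<le> C * sqrt (real (Suc m))" if "i \<in> I m" for m i
    proof (cases "m < m0")
      case True
      then have "\<bar>\<xi> m i \<omega>\<bar> \<le> C * 1" using that C by (auto simp: F_def)
      also have "\<dots> \<le> C * sqrt (real (Suc m))" using C \<open>0 < R\<close> by (intro mult_left_mono) auto
      finally show ?thesis .
    next
      case False
      then have "\<bar>\<xi> m i \<omega>\<bar> \<le> R * sqrt (real (Suc m))" using m0[of m] that by (auto simp: A_def not_le)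
      also have "\<dots> \<le> C * sqrt (real (Suc m))" using C by (intro mult_right_mono) auto
      finally show ?thesis .
    qed
    then show ?case using C(1) \<open>0 < R\<close> by (intro exI[of _ C]) auto
  qed
qed


section \<open>Variance of the increments\<close>

lemma XHK_kernel_borel [measurable]: "XHK_kernel H K t \<in> borel_measurable borel"
  unfolding XHK_kernel_def[abs_def] by measurable

text \<open>The kernel depends on \<open>t\<close> through \<open>\<theta> t\<^sup>2\<^sup>H\<close> only, so the substitution \<open>\<theta> \<mapsto> \<theta> / t\<^sup>2\<^sup>H\<close> exhibits the
  self-similarity of the process. The finiteness of the integral at \<open>t = 1\<close> is part of the existence of
  the Wiener integral.\<close>

lemma XHK_kernel_scaling:
  assumes "0 < t"
  shows "(\<integral>\<^sup>+\<theta>\<in>{0..}. ennreal ((XHK_kernel H K t \<theta>)\<^sup>2) \<partial>lborel)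
    = ennreal (t powr (2 * (H * K))) * (\<integral>\<^sup>+\<theta>\<in>{0..}. ennreal ((XHK_kernel H K 1 \<theta>)\<^sup>2) \<partial>lborel)"
proof -
  define a where "a = t powr (2 * H)"
  have "0 < a" using assms by (simp add: a_def)
  have kernel: "ennreal ((XHK_kernel H K t (0 + 1 / a * \<theta>))\<^sup>2) * indicator {0..} (0 + 1 / a * \<theta>)
      = ennreal (a powr (1 + K)) * (ennreal ((XHK_kernel H K 1 \<theta>)\<^sup>2) * indicator {0..} \<theta>)" for \<theta>
  proof (cases "0 \<le> \<theta>")
    case True
    have "(\<theta> / a) powr (- p) = a powr p * \<theta> powr (- p)" for p
      using True \<open>0 < a\<close> by (simp add: powr_divide powr_minus_divide)
    then have "XHK_kernel H K t (\<theta> / a) = a powr ((1 + K) / 2) * XHK_kernel H K 1 \<theta>"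
      using \<open>0 < a\<close> by (simp add: XHK_kernel_def a_def[symmetric] del: minus_divide_left)
    then have "(XHK_kernel H K t (\<theta> / a))\<^sup>2 = a powr (1 + K) * (XHK_kernel H K 1 \<theta>)\<^sup>2"
      using \<open>0 < a\<close> by (simp add: power_mult_distrib power2_eq_square[of "a powr _"] flip: powr_add)
    then show ?thesis using True \<open>0 < a\<close> by (simp add: ennreal_mult)
  next
    case False
    then have "\<theta> / a < 0" using \<open>0 < a\<close> by (simp add: divide_neg_pos)
    then show ?thesis using False by simp
  qed
  have "(\<integral>\<^sup>+\<theta>\<in>{0..}. ennreal ((XHK_kernel H K t \<theta>)\<^sup>2) \<partial>lborel)
      = ennreal \<bar>1 / a\<bar> * (\<integral>\<^sup>+\<theta>. ennreal ((XHK_kernel H K t (0 + 1 / a * \<theta>))\<^sup>2) * indicator {0..} (0 + 1 / a * \<theta>) \<partial>lborel)"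
    using \<open>0 < a\<close> by (intro nn_integral_real_affine) auto
  also have "\<dots> = ennreal (1 / a) * (ennreal (a powr (1 + K)) *
      (\<integral>\<^sup>+\<theta>\<in>{0..}. ennreal ((XHK_kernel H K 1 \<theta>)\<^sup>2) \<partial>lborel))"
    unfolding kernel using \<open>0 < a\<close> by (simp add: nn_integral_cmult)
  also have "\<dots> = ennreal (1 / a * a powr (1 + K)) * (\<integral>\<^sup>+\<theta>\<in>{0..}. ennreal ((XHK_kernel H K 1 \<theta>)\<^sup>2) \<partial>lborel)"
    using \<open>0 < a\<close> by (subst mult.assoc[symmetric], subst ennreal_mult[symmetric]) auto
  also have "1 / a * a powr (1 + K) = t powr (2 * (H * K))"
    using \<open>0 < a\<close> assms by (simp add: powr_add) (simp add: a_def powr_powr mult.assoc)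
  finally show ?thesis .
qed

text \<open>With \<open>a = s\<^sup>2\<^sup>H\<close> and \<open>b = (s + h)\<^sup>2\<^sup>H\<close>, the increment \<open>e\<^sup>-\<^sup>\<theta>\<^sup>a - e\<^sup>-\<^sup>\<theta>\<^sup>b\<close> is at most
  \<open>\<theta> (b - a) e\<^sup>-\<^sup>\<theta>\<^sup>a\<close>, and \<open>x e\<^sup>-\<^sup>x \<le> 1 - e\<^sup>-\<^sup>x\<close> turns this into \<open>((b - a)/a) (1 - e\<^sup>-\<^sup>\<theta>\<^sup>a)\<close>: a multiple of the kernel at \<open>s\<close>
  itself. The relative increment \<open>(b - a)/a\<close> is \<open>(1 + h/s)\<^sup>2\<^sup>H - 1 \<le> (1 + h/s)\<^sup>2 - 1 \<le> 5 h/s\<close>, since \<open>H \<le> 1\<close> and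
  \<open>h \<le> 3s\<close>.\<close>

lemma XHK_kernel_increment:
  assumes H: "0 < H" "H < 1" and s: "0 < s" and h: "0 \<le> h" "h \<le> 3 * s" and "0 \<le> \<theta>"
  shows "\<bar>XHK_kernel H K (s + h) \<theta> - XHK_kernel H K s \<theta>\<bar> \<le> 5 * (h / s) * XHK_kernel H K s \<theta>"
proof -
  define a b q where "a = s powr (2 * H)" and "b = (s + h) powr (2 * H)" and "q = 5 * (h / s)"
  have "0 < a" "0 \<le> q" using s h by (auto simp: a_def q_def)
  have "a \<le> b" using s h H unfolding a_def b_def by (intro powr_mono2) auto
  have "b \<le> a * (1 + q)"
  proof -
    have "s + h = s * (1 + h / s)" using s by (simp add: field_simps)
    then have "b = a * (1 + h / s) powr (2 * H)"
      using s h by (simp add: a_def b_def powr_mult)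
    also have "(1 + h / s) powr (2 * H) \<le> (1 + h / s) powr 2"
      using H s h by (intro powr_mono) auto
    also have "(1 + h / s) powr 2 = 1 + h / s * (2 + h / s)"
      using s h by (simp add: powr_numeral power2_eq_square algebra_simps)
    also have "h / s * (2 + h / s) \<le> h / s * 5"
      using s h by (intro mult_left_mono) (auto simp: field_simps)
    finally show ?thesis using \<open>0 < a\<close> by (simp add: q_def mult_ac)
  qed
  have "exp (- \<theta> * a) - exp (- \<theta> * b) \<le> q * (1 - exp (- \<theta> * a))"
  proof -
    have "exp (- \<theta> * a) - exp (- \<theta> * b) = exp (- \<theta> * a) * (1 - exp (- (\<theta> * (b - a))))"
      by (simp add: right_diff_distrib mult_exp_exp algebra_simps)
    also have "\<dots> \<le> exp (- \<theta> * a) * (\<theta> * (a * q))"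
    proof (rule mult_left_mono)
      have "1 - exp (- (\<theta> * (b - a))) \<le> \<theta> * (b - a)"
        using exp_ge_add_one_self[of "- (\<theta> * (b - a))"] by linarith
      also have "\<dots> \<le> \<theta> * (a * q)"
        using \<open>b \<le> a * (1 + q)\<close> \<open>0 \<le> \<theta>\<close> by (intro mult_left_mono) (auto simp: algebra_simps)
      finally show "1 - exp (- (\<theta> * (b - a))) \<le> \<theta> * (a * q)" .
    qed simp
    also have "\<dots> = q * (exp (- \<theta> * a) * (\<theta> * a))" by simp
    also have "\<dots> \<le> q * (1 - exp (- \<theta> * a))"
    proof (rule mult_left_mono)
      have "exp (- \<theta> * a) * (1 + \<theta> * a) \<le> exp (- \<theta> * a) * exp (\<theta> * a)"
        by (intro mult_left_mono exp_ge_add_one_self) auto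
      then show "exp (- \<theta> * a) * (\<theta> * a) \<le> 1 - exp (- \<theta> * a)"
        by (simp add: mult_exp_exp distrib_left)
    qed fact
    finally show ?thesis .
  qed
  moreover have "exp (- \<theta> * b) \<le> exp (- \<theta> * a)"
    using \<open>a \<le> b\<close> \<open>0 \<le> \<theta>\<close> by (simp add: mult_left_mono)
  ultimately have "\<bar>(1 - exp (- \<theta> * b)) - (1 - exp (- \<theta> * a))\<bar> \<le> q * (1 - exp (- \<theta> * a))"
    by linarith
  then have "\<bar>(1 - exp (- \<theta> * b)) - (1 - exp (- \<theta> * a))\<bar> * \<theta> powr (- ((1 + K) / 2))
      \<le> q * (1 - exp (- \<theta> * a)) * \<theta> powr (- ((1 + K) / 2))"
    by (rule mult_right_mono) simp
  then show ?thesis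
    by (simp add: XHK_kernel_def a_def b_def q_def abs_mult left_diff_distrib[symmetric] mult.assoc)
qed

lemma XHK_tails:
  assumes H: "0 < H" "H < 1" and W: "standard_brownian_motion M W"
    and X: "\<And>t. 0 < t \<Longrightarrow> is_wiener_integral M W (XHK_kernel H K t) (X t)"
  obtains b where "0 < b"
    "\<And>s r. 0 < s \<Longrightarrow> 0 < r \<Longrightarrow>
      emeasure M {\<omega> \<in> space M. r \<le> \<bar>X s \<omega> / s powr (H * K)\<bar>} \<le> ennreal (2 * exp (- (r\<^sup>2 / b)))"
    "\<And>s h r. 0 < s \<Longrightarrow> 0 < h \<Longrightarrow> h \<le> 3 * s \<Longrightarrow> 0 < r \<Longrightarrow>
      emeasure M {\<omega> \<in> space M. r \<le> \<bar>(X (s + h) \<omega> - X s \<omega>) / (h / s * s powr (H * K))\<bar>}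
        \<le> ennreal (2 * exp (- (r\<^sup>2 / b)))"
proof -
  define V where "V t = (\<integral>\<^sup>+\<theta>\<in>{0..}. ennreal ((XHK_kernel H K t \<theta>)\<^sup>2) \<partial>lborel)" for t
  have "set_integrable lborel {0..} (\<lambda>\<theta>. (XHK_kernel H K 1 \<theta>)\<^sup>2)"
    using X[of 1] by (simp add: is_wiener_integral_def)
  then have "V 1 < \<infinity>"
    unfolding set_integrable_def V_def
    by (subst nn_integral_set_ennreal) (simp add: nn_integral_eq_integral mult.commute)
  then obtain v0 where "0 \<le> v0" "V 1 = ennreal v0" by (cases "V 1") auto
  define v where "v = 25 * (v0 + 1)"
  have v: "V 1 \<le> ennreal v" "25 * V 1 \<le> ennreal v" "0 < v"
  proof -
    have "25 * ennreal v0 = ennreal (25 * v0)" using \<open>0 \<le> v0\<close> by (simp add: ennreal_mult)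
    then show "25 * V 1 \<le> ennreal v" unfolding \<open>V 1 = ennreal v0\<close> by (simp only:) (rule ennreal_leI, simp add: v_def)
    show "V 1 \<le> ennreal v" unfolding \<open>V 1 = ennreal v0\<close> using \<open>0 \<le> v0\<close> by (intro ennreal_leI) (simp add: v_def)
  qed (use \<open>0 \<le> v0\<close> in \<open>simp add: v_def\<close>)
  have V: "V s = ennreal (s powr (2 * (H * K))) * V 1" if "0 < s" for s
    unfolding V_def by (rule XHK_kernel_scaling[OF that])
  have powr_sq: "s powr (2 * (H * K)) = (s powr (H * K))\<^sup>2" for s :: real
    by (simp add: power2_eq_square flip: powr_add)
  show ?thesis
  proof (rule that[of "32 * v"])
    fix s r :: real assume "0 < s" "0 < r"
    have "(\<integral>\<^sup>+\<theta>\<in>{0..}. ennreal ((XHK_kernel H K s \<theta> - 0)\<^sup>2) \<partial>lborel) \<le> ennreal ((s powr (H * K))\<^sup>2 * v)"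
      using V[OF \<open>0 < s\<close>] v mult_left_mono[OF v(1), of "ennreal ((s powr (H * K))\<^sup>2)"]
      by (simp add: powr_sq ennreal_mult flip: V_def)
    from wiener_integral_difference_tail[OF W X[OF \<open>0 < s\<close>] wiener_integral_zero this, of "r * s powr (H * K)"]
    show "emeasure M {\<omega> \<in> space M. r \<le> \<bar>X s \<omega> / s powr (H * K)\<bar>} \<le> ennreal (2 * exp (- (r\<^sup>2 / (32 * v))))"
      using \<open>0 < s\<close> \<open>0 < r\<close> \<open>0 < v\<close> by (simp add: abs_divide pos_le_divide_eq power_mult_distrib)
  next
    fix s h r :: real assume s: "0 < s" and h: "0 < h" "h \<le> 3 * s" and "0 < r"
    define w where "w = h / s * s powr (H * K)"
    have "0 < w" using s h by (simp add: w_def)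
    have "(\<integral>\<^sup>+\<theta>\<in>{0..}. ennreal ((XHK_kernel H K (s + h) \<theta> - XHK_kernel H K s \<theta>)\<^sup>2) \<partial>lborel)
        \<le> (\<integral>\<^sup>+\<theta>. ennreal ((5 * (h / s))\<^sup>2) * (ennreal ((XHK_kernel H K s \<theta>)\<^sup>2) * indicator {0..} \<theta>) \<partial>lborel)"
    proof (rule nn_integral_mono)
      fix \<theta> :: real
      have "(XHK_kernel H K (s + h) \<theta> - XHK_kernel H K s \<theta>)\<^sup>2 \<le> (5 * (h / s))\<^sup>2 * (XHK_kernel H K s \<theta>)\<^sup>2" if "0 \<le> \<theta>"
        using power_mono[OF XHK_kernel_increment[OF H s _ h(2) that, of K], of 2] h
        by (simp only: power2_abs power_mult_distrib)
      then show "ennreal ((XHK_kernel H K (s + h) \<theta> - XHK_kernel H K s \<theta>)\<^sup>2) * indicator {0..} \<theta>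
          \<le> ennreal ((5 * (h / s))\<^sup>2) * (ennreal ((XHK_kernel H K s \<theta>)\<^sup>2) * indicator {0..} \<theta>)"
        by (auto simp: indicator_def ennreal_leI simp flip: ennreal_mult)
    qed
    also have "\<dots> = ennreal ((5 * (h / s))\<^sup>2) * (ennreal ((s powr (H * K))\<^sup>2) * V 1)"
      using V[OF s] by (simp add: nn_integral_cmult powr_sq flip: V_def)
    also have "\<dots> = ennreal (w\<^sup>2) * (25 * V 1)"
    proof -
      have "ennreal ((5 * (h / s))\<^sup>2) * (ennreal ((s powr (H * K))\<^sup>2)) = ennreal (w\<^sup>2) * 25"
        by (simp add: w_def power_mult_distrib power_divide mult_ac flip: ennreal_mult ennreal_numeral)
      then show ?thesis by (simp flip: mult.assoc)
    qed
    also have "\<dots> \<le> ennreal (w\<^sup>2) * ennreal v" by (intro mult_left_mono v) simp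
    also have "\<dots> = ennreal (w\<^sup>2 * v)" using v by (simp add: ennreal_mult)
    finally have L2: "(\<integral>\<^sup>+\<theta>\<in>{0..}. ennreal ((XHK_kernel H K (s + h) \<theta> - XHK_kernel H K s \<theta>)\<^sup>2) \<partial>lborel) \<le> ennreal (w\<^sup>2 * v)" .
    have "0 < s + h" using s h by simp
    from wiener_integral_difference_tail[OF W X[OF this] X[OF s] L2, of "r * w"]
    show "emeasure M {\<omega> \<in> space M. r \<le> \<bar>(X (s + h) \<omega> - X s \<omega>) / (h / s * s powr (H * K))\<bar>}
        \<le> ennreal (2 * exp (- (r\<^sup>2 / (32 * v))))"
      unfolding w_def[symmetric] using \<open>0 < w\<close> \<open>0 < r\<close> \<open>0 < v\<close>
      by (simp add: abs_divide pos_le_divide_eq power_mult_distrib)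
  qed (use v in simp)
qed


section \<open>Chaining along dyadic points\<close>

lemma dyadic_scale:
  fixes x :: real
  assumes "0 < x" "x \<le> 1"
  obtains n :: nat where "1 / 2 ^ Suc n < x" "x \<le> 1 / 2 ^ n"
proof -
  obtain m where "(1 / 2) ^ m < x" using real_arch_pow_inv[of x "1/2"] assms by auto
  define k where "k = (LEAST m. (1 / 2) ^ m < x)"
  have k: "(1 / 2) ^ k < x" unfolding k_def by (rule LeastI) fact
  then have "k \<noteq> 0" using assms by (auto intro: gr0I)
  then obtain n where n: "k = Suc n" by (cases k) auto
  then have "\<not> (1 / 2) ^ n < x" using not_less_Least[of n "\<lambda>m. (1 / 2) ^ m < x"] by (simp add: k_def)
  then show thesis using that[of n] k n by (simp add: power_one_over not_less)
qed

text \<open>The dyadic points \<open>\<lfloor>2\<^sup>m x\<rfloor> / 2\<^sup>m\<close>, \<open>m \<ge> n\<close>, converge to \<open>x\<close>, and consecutive ones either agree or are neighbours at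
  the finer level, so the errors form a geometric series.\<close>

lemma dyadic_floor_chain:
  fixes g :: "real \<Rightarrow> real" and q B x :: real
  assumes cont: "continuous_on {0..1} g" and q: "0 < q" "q < 1" and "0 \<le> B"
    and inc: "\<And>n j. j < 2 ^ n \<Longrightarrow> \<bar>g (real (Suc j) / 2 ^ n) - g (real j / 2 ^ n)\<bar> \<le> B * q ^ n"
    and x: "0 \<le> x" "x \<le> 1"
  shows "\<bar>g x - g (real (nat \<lfloor>2 ^ n * x\<rfloor>) / 2 ^ n)\<bar> \<le> B * q ^ n / (1 - q)"
proof -
  define d where "d n = real (nat \<lfloor>2 ^ n * x\<rfloor>) / 2 ^ n" for n
  have d_floor: "d n = of_int \<lfloor>2 ^ n * x\<rfloor> / 2 ^ n" for n
    using x by (simp add: d_def)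
  have d_unit: "d n \<in> {0..1}" for n
  proof -
    have "of_int \<lfloor>2 ^ n * x\<rfloor> \<le> 2 ^ n * x" by simp
    also have "\<dots> \<le> 2 ^ n" using x by simp
    finally show ?thesis using x by (simp add: d_floor field_simps)
  qed
  have step: "\<bar>g (d (Suc n)) - g (d n)\<bar> \<le> B * q ^ Suc n" for n
  proof -
    define j where "j = nat \<lfloor>2 ^ n * x\<rfloor>"
    have j: "d n = real (2 * j) / 2 ^ Suc n" by (simp add: d_def j_def)
    have "\<lfloor>2 ^ Suc n * x\<rfloor> = 2 * \<lfloor>2 ^ n * x\<rfloor> \<or> \<lfloor>2 ^ Suc n * x\<rfloor> = 2 * \<lfloor>2 ^ n * x\<rfloor> + 1"
      unfolding power_Suc mult.assoc by linarith
    moreover have "0 \<le> \<lfloor>2 ^ n * x\<rfloor>" using x by simp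
    moreover have "nat k = 2 * nat m \<or> nat k = Suc (2 * nat m)"
      if "k = 2 * m \<or> k = 2 * m + 1" "0 \<le> m" for k m :: int
      using that by arith
    ultimately consider "nat \<lfloor>2 ^ Suc n * x\<rfloor> = 2 * j" | "nat \<lfloor>2 ^ Suc n * x\<rfloor> = Suc (2 * j)"
      unfolding j_def by blast
    then show ?thesis
    proof cases
      case 1
      then have "d (Suc n) = d n" unfolding j by (simp add: d_def)
      then show ?thesis using \<open>0 \<le> B\<close> q by simp
    next
      case 2
      then have eq: "d (Suc n) = real (Suc (2 * j)) / 2 ^ Suc n" by (simp add: d_def)
      moreover have "2 * j < 2 ^ Suc n"
      proof -
        have "real (Suc (2 * j)) \<le> 2 ^ Suc n"
          using d_unit[of "Suc n"] unfolding eq by (simp add: field_simps)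
        then have "Suc (2 * j) \<le> 2 ^ Suc n"
          by (metis of_nat_le_iff of_nat_numeral of_nat_power)
        then show ?thesis by simp
      qed
      ultimately show ?thesis using inc[of "2 * j" "Suc n"] unfolding j by simp
    qed
  qed
  have chain: "\<bar>g (d (n + k)) - g (d n)\<bar> \<le> B * q ^ n * (1 - q ^ k) / (1 - q)" for k
  proof (induction k)
    case (Suc k)
    have "\<bar>g (d (n + Suc k)) - g (d n)\<bar> \<le> B * q ^ Suc (n + k) + B * q ^ n * (1 - q ^ k) / (1 - q)"
      using Suc step[of "n + k"] by (simp del: power_Suc)
    also have "\<dots> \<le> B * q ^ (n + k) + B * q ^ n * (1 - q ^ k) / (1 - q)"
      using q \<open>0 \<le> B\<close> by (intro add_right_mono mult_left_mono power_decreasing) auto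
    also have "\<dots> = B * q ^ n * (1 - q ^ Suc k) / (1 - q)"
      using q by (simp add: field_simps power_add)
    finally show ?case .
  qed simp
  have "d \<longlonglongrightarrow> x"
  proof (rule real_tendsto_sandwich)
    show "\<forall>\<^sub>F n in sequentially. x - (1 / 2) ^ n \<le> d n"
    proof (rule always_eventually, rule allI)
      fix n
      have "x - (1 / 2) ^ n = (2 ^ n * x - 1) / 2 ^ n" by (simp add: field_simps)
      also have "\<dots> \<le> of_int \<lfloor>2 ^ n * x\<rfloor> / 2 ^ n" by (intro divide_right_mono) (linarith, simp)
      finally show "x - (1 / 2) ^ n \<le> d n" by (simp add: d_floor)
    qed
    show "\<forall>\<^sub>F n in sequentially. d n \<le> x"
      by (intro always_eventually allI) (simp add: d_floor field_simps)
    show "(\<lambda>n. x - (1 / 2) ^ n) \<longlonglongrightarrow> x"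
      using tendsto_diff[OF tendsto_const LIMSEQ_power_zero[of "1/2 :: real"], of x] by simp
  qed simp
  then have "(\<lambda>n. g (d n)) \<longlonglongrightarrow> g x"
    using cont d_unit x by (intro continuous_on_tendsto_compose[OF cont]) auto
  then have "(\<lambda>k. g (d (n + k))) \<longlonglongrightarrow> g x"
    using LIMSEQ_ignore_initial_segment[of "\<lambda>n. g (d n)" "g x" n] by (simp add: add.commute)
  then have "(\<lambda>k. \<bar>g (d (n + k)) - g (d n)\<bar>) \<longlonglongrightarrow> \<bar>g x - g (d n)\<bar>"
    by (intro tendsto_intros)
  then have "\<bar>g x - g (d n)\<bar> \<le> B * q ^ n / (1 - q)"
  proof (rule LIMSEQ_le_const2, intro exI allI impI)
    fix k
    have "B * q ^ n * (1 - q ^ k) / (1 - q) \<le> B * q ^ n * 1 / (1 - q)"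
      using q \<open>0 \<le> B\<close> by (intro divide_right_mono mult_left_mono) auto
    then show "\<bar>g (d (n + k)) - g (d n)\<bar> \<le> B * q ^ n / (1 - q)" using chain[of k] by simp
  qed
  then show ?thesis by (simp add: d_def)
qed

lemma dyadic_increments_imp_holder:
  fixes g :: "real \<Rightarrow> real"
  assumes cont: "continuous_on {0..1} g" and "0 < \<gamma>" and "0 \<le> B"
    and inc: "\<And>n j. j < 2 ^ n \<Longrightarrow> \<bar>g (real (Suc j) / 2 ^ n) - g (real j / 2 ^ n)\<bar> \<le> B * (2 powr - \<gamma>) ^ n"
    and xy: "0 \<le> x" "x \<le> y" "y \<le> 1"
  shows "\<bar>g y - g x\<bar> \<le> 2 powr \<gamma> * (1 + 2 / (1 - 2 powr - \<gamma>)) * B * (y - x) powr \<gamma>"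
proof (cases "x = y")
  case False
  define q where "q = (2::real) powr - \<gamma>"
  have q: "0 < q" "q < 1" using \<open>0 < \<gamma>\<close> by (auto simp: q_def powr_less_one)
  obtain n where n: "1 / 2 ^ Suc n < y - x" "y - x \<le> 1 / 2 ^ n"
    using dyadic_scale[of "y - x"] xy False by auto
  define i j where "i = nat \<lfloor>2 ^ n * x\<rfloor>" and "j = nat \<lfloor>2 ^ n * y\<rfloor>"
  have "2 ^ n * y \<le> 2 ^ n * x + 1" using n(2) by (simp add: field_simps)
  moreover have "2 ^ n * x \<le> 2 ^ n * y" using xy by simp
  ultimately have "\<lfloor>2 ^ n * y\<rfloor> = \<lfloor>2 ^ n * x\<rfloor> \<or> \<lfloor>2 ^ n * y\<rfloor> = \<lfloor>2 ^ n * x\<rfloor> + 1" by linarith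
  moreover have "0 \<le> \<lfloor>2 ^ n * x\<rfloor>" using xy by simp
  moreover have "nat k = nat m \<or> nat k = Suc (nat m)" if "k = m \<or> k = m + 1" "0 \<le> m" for k m :: int
    using that by arith
  ultimately consider "j = i" | "j = Suc i" unfolding i_def j_def by blast
  then have mid: "\<bar>g (real j / 2 ^ n) - g (real i / 2 ^ n)\<bar> \<le> B * q ^ n"
  proof cases
    case 2
    have "real j \<le> 2 ^ n * y" using xy by (simp add: j_def)
    also have "\<dots> \<le> 2 ^ n" using xy by simp
    finally have "j \<le> 2 ^ n" by (metis of_nat_le_iff of_nat_numeral of_nat_power)
    then show ?thesis using 2 inc[of i n] by (simp add: q_def)
  qed (use \<open>0 \<le> B\<close> q in simp)
  have ends: "\<bar>g z - g (real (nat \<lfloor>2 ^ n * z\<rfloor>) / 2 ^ n)\<bar> \<le> B * q ^ n / (1 - q)" if "z \<in> {x, y}" for z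
    using that xy inc by (intro dyadic_floor_chain[OF cont q \<open>0 \<le> B\<close>]) (auto simp: q_def)
  have "q ^ n \<le> 2 powr \<gamma> * (y - x) powr \<gamma>"
  proof -
    have "q ^ n = 2 powr \<gamma> * (1 / 2 ^ Suc n) powr \<gamma>"
    proof -
      have "(1 / 2 ^ Suc n :: real) = 2 powr - real (Suc n)"
        by (simp only: powr_minus_divide powr_realpow zero_less_numeral)
      then have "2 powr \<gamma> * (1 / 2 ^ Suc n) powr \<gamma> = 2 powr (\<gamma> + - real (Suc n) * \<gamma>)"
        by (simp add: powr_powr powr_add)
      also have "\<gamma> + - real (Suc n) * \<gamma> = - \<gamma> * real n" by (simp add: algebra_simps)
      also have "2 powr (- \<gamma> * real n) = q ^ n"
        unfolding q_def by (simp add: powr_powr flip: powr_realpow)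
      finally show ?thesis ..
    qed
    also have "\<dots> \<le> 2 powr \<gamma> * (y - x) powr \<gamma>"
      using n(1) \<open>0 < \<gamma>\<close> by (intro mult_left_mono powr_mono2) auto
    finally show ?thesis .
  qed
  have "\<bar>g y - g x\<bar> \<le> B * q ^ n + 2 * (B * q ^ n / (1 - q))"
    using mid ends[of x] ends[of y] unfolding i_def j_def by simp
  also have "\<dots> = (1 + 2 / (1 - q)) * B * q ^ n" by (simp add: algebra_simps)
  also have "\<dots> \<le> (1 + 2 / (1 - q)) * B * (2 powr \<gamma> * (y - x) powr \<gamma>)"
    using \<open>0 \<le> B\<close> q \<open>q ^ n \<le> 2 powr \<gamma> * (y - x) powr \<gamma>\<close> by (intro mult_left_mono) auto
  finally show ?thesis by (simp add: q_def mult_ac)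
qed (use \<open>0 < \<gamma>\<close> in simp)


section \<open>From dyadic increments to a modulus with logarithmic weight\<close>

text \<open>The dyadic points of level \<open>n\<close> in the block \<open>[c, 4c]\<close> with \<open>c = 2\<^sup>-\<^sup>k\<^sup>-\<^sup>1\<close>. The blocks overlap, so that
  \<open>[s, 2s]\<close> lies in one block whenever \<open>s\<close> is in the lower part \<open>[c, 2c]\<close>, and no increment of length at
  most \<open>s\<close> has to be split between blocks.\<close>

definition block_point :: "nat \<Rightarrow> nat \<Rightarrow> nat \<Rightarrow> real" where
  "block_point k n j = (1 + 3 * (real j / 2 ^ n)) / 2 ^ Suc k"

definition block_mesh :: "nat \<Rightarrow> nat \<Rightarrow> real" where
  "block_mesh k n = 3 / 2 ^ n / 2 ^ Suc k"

definition log_weight :: "real \<Rightarrow> real" where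
  "log_weight s = sqrt (1 + ln (1 / s))"

lemma block_point_Suc: "block_point k n (Suc j) = block_point k n j + block_mesh k n"
  by (simp add: block_point_def block_mesh_def field_simps)

lemma block_point_pos: "0 < block_point k n j"
  by (simp add: block_point_def add_pos_nonneg)

lemma block_mesh_pos: "0 < block_mesh k n"
  by (simp add: block_mesh_def)

lemma block_point_ge: "1 / 2 ^ Suc k \<le> block_point k n j"
  unfolding block_point_def by (intro divide_right_mono) auto

lemma block_mesh_le: "block_mesh k n \<le> 3 / 2 ^ n * block_point k n j"
  using mult_left_mono[OF block_point_ge[of k n j], of "3 / 2 ^ n"] by (simp add: block_mesh_def)

lemma block_mesh_le3: "block_mesh k n \<le> 3 * block_point k n j"
proof -
  have "3 / 2 ^ n * block_point k n j \<le> 3 * block_point k n j"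
    using block_point_pos[of k n j] by (intro mult_right_mono) (auto simp: field_simps)
  then show ?thesis using block_mesh_le[of k n j] by linarith
qed

lemma log_weight_nonneg: "0 < s \<Longrightarrow> s \<le> 1 \<Longrightarrow> 0 \<le> log_weight s"
  by (simp add: log_weight_def)

lemma log_weight_antimono:
  assumes "0 < s" "s \<le> s'" "s' \<le> 1"
  shows "log_weight s' \<le> log_weight s"
  using assms by (simp add: log_weight_def ln_div)

lemma sqrt_level_le_log_weight:
  assumes "0 < s" "s \<le> 1 / 2 ^ k"
  shows "sqrt (real (Suc k)) \<le> 2 * log_weight s"
proof -
  have "2 ^ k \<le> 1 / s" using assms by (simp add: field_simps)
  then have "ln (2 ^ k) \<le> ln (1 / s)" using assms by (intro ln_mono) auto
  moreover have "real k * (2 / 3) \<le> real k * ln 2" using ln2_ge_two_thirds by (intro mult_left_mono) auto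
  ultimately have "real (Suc k) \<le> 2\<^sup>2 * (1 + ln (1 / s))"
    by (simp add: ln_realpow)
  then have "sqrt (real (Suc k)) \<le> sqrt (2\<^sup>2 * (1 + ln (1 / s)))" by (rule real_sqrt_le_mono)
  also have "\<dots> = 2 * log_weight s" by (simp only: real_sqrt_mult real_sqrt_abs log_weight_def abs_numeral)
  finally show ?thesis .
qed

lemma sqrt_times_geometric_bounded:
  fixes r :: real
  assumes "0 < r" "r < 1"
  obtains M where "0 < M" "\<And>n. sqrt (real (Suc n)) * r ^ n \<le> M"
proof -
  have "(\<lambda>n. real n * r ^ n + r ^ n) \<longlonglongrightarrow> 0 + 0"
    using assms by (intro tendsto_add powser_times_n_limit_0 LIMSEQ_power_zero) auto
  then have "Bseq (\<lambda>n. real n * r ^ n + r ^ n)" by (auto intro: convergent_imp_Bseq convergentI)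
  then obtain M where M: "0 < M" "\<And>n. \<bar>real n * r ^ n + r ^ n\<bar> \<le> M" by (auto simp: Bseq_def)
  have "sqrt (real (Suc n)) * r ^ n \<le> M" for n
  proof -
    have "sqrt (real (Suc n)) \<le> real (Suc n)" by (rule real_le_lsqrt) (auto simp: power2_eq_square)
    then have "sqrt (real (Suc n)) * r ^ n \<le> real (Suc n) * r ^ n"
      using assms by (intro mult_right_mono) auto
    also have "\<dots> \<le> M" using M(2)[of n] by (simp add: algebra_simps)
    finally show ?thesis .
  qed
  then show thesis using that M(1) by blast
qed

text \<open>On the block with index \<open>k\<close> the assumption reads, up to constants,
  \<open>c\<^sup>\<alpha> (k + 1)\<^sup>1\<^sup>/\<^sup>2 (n + 1)\<^sup>1\<^sup>/\<^sup>2 2\<^sup>-\<^sup>n\<close>. As \<open>\<alpha> < 1\<close>, the factors depending on \<open>n\<close> are \<open>O(2\<^sup>-\<^sup>n\<^sup>\<alpha>)\<close>, so chaining on the rescaled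
  block gives the Hoelder exponent \<open>\<alpha>\<close>. Undoing the rescaling cancels \<open>c\<^sup>\<alpha>\<close> and leaves \<open>(k + 1)\<^sup>1\<^sup>/\<^sup>2\<close>.\<close>

lemma dyadic_bounds_imp_log_modulus:
  fixes f :: "real \<Rightarrow> real"
  assumes cont: "continuous_on {0..} f" and \<alpha>: "0 < \<alpha>" "\<alpha> < 1" and "0 \<le> C"
    and point: "\<And>k. \<bar>f (1 / 2 ^ Suc k)\<bar> \<le> C * sqrt (real (Suc k)) * (1 / 2 ^ Suc k) powr \<alpha>"
    and inc: "\<And>k n j. j < 2 ^ n \<Longrightarrow> \<bar>f (block_point k n (Suc j)) - f (block_point k n j)\<bar>
      \<le> C * sqrt (real (Suc (k + n))) * (block_mesh k n / block_point k n j * block_point k n j powr \<alpha>)"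
  obtains D where "0 \<le> D"
    "\<And>s. 0 < s \<Longrightarrow> s \<le> 1 \<Longrightarrow> \<bar>f s\<bar> \<le> D * s powr \<alpha> * log_weight s"
    "\<And>s h. 0 < s \<Longrightarrow> s \<le> 1 \<Longrightarrow> 0 \<le> h \<Longrightarrow> h \<le> s \<Longrightarrow> \<bar>f (s + h) - f s\<bar> \<le> D * h powr \<alpha> * log_weight s"
proof -
  define q where "q = (2::real) powr - \<alpha>"
  have q: "0 < q" "q < 1" using \<alpha> by (auto simp: q_def powr_less_one)
  have "1 / 2 < q"
    using \<alpha> powr_less_mono[of "-1" "- \<alpha>" 2] by (simp add: q_def powr_minus_divide)
  then obtain M where M: "0 < M" "\<And>n. sqrt (real (Suc n)) * (1 / 2 / q) ^ n \<le> M"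
    using sqrt_times_geometric_bounded[of "1 / 2 / q"] q by (auto simp: field_simps)
  define A where "A = 2 powr \<alpha> * (1 + 2 / (1 - q))"
  have "0 \<le> A" using q by (simp add: A_def)
  have block: "\<bar>f (s + h) - f s\<bar> \<le> A * 12 * C * M * sqrt (real (Suc k)) * h powr \<alpha>"
    if s: "1 / 2 ^ Suc k \<le> s" "s \<le> 1 / 2 ^ k" and h: "0 \<le> h" "h \<le> s" for k s h
  proof -
    define c where "c = (1::real) / 2 ^ Suc k"
    have c: "0 < c" "c \<le> s" "s \<le> 2 * c" using s by (auto simp: c_def)
    define g where "g x = f (c * (1 + 3 * x))" for x
    define B where "B = 12 * C * M * sqrt (real (Suc k)) * c powr \<alpha>"
    have "0 \<le> B" using \<open>0 \<le> C\<close> M c by (simp add: B_def)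
    have cont_g: "continuous_on {0..1} g"
      unfolding g_def using c
      by (intro continuous_on_compose2[OF cont] continuous_intros) auto
    have "\<bar>g (real (Suc j) / 2 ^ n) - g (real j / 2 ^ n)\<bar> \<le> B * (2 powr - \<alpha>) ^ n" if j: "j < 2 ^ n" for n j
    proof -
      define b where "b = block_point k n j"
      have "0 < b" unfolding b_def by (rule block_point_pos)
      have "real j \<le> 2 ^ n" using j by (metis less_imp_le of_nat_le_iff of_nat_numeral of_nat_power)
      then have "b \<le> 4 * c" unfolding b_def block_point_def c_def by (simp add: field_simps)
      have "sqrt (real (Suc (k + n))) \<le> sqrt (real (Suc k)) * sqrt (real (Suc n))"
        unfolding real_sqrt_mult[symmetric] by (rule real_sqrt_le_mono) (simp add: algebra_simps)
      moreover have "block_mesh k n / b \<le> 3 / 2 ^ n"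
        using block_mesh_le[of k n j] \<open>0 < b\<close> by (simp add: b_def pos_divide_le_eq)
      moreover have "b powr \<alpha> \<le> 4 * c powr \<alpha>"
      proof -
        have "b powr \<alpha> \<le> (4 * c) powr \<alpha>" using \<open>0 < b\<close> \<open>b \<le> 4 * c\<close> \<alpha> by (intro powr_mono2) auto
        also have "\<dots> = 4 powr \<alpha> * c powr \<alpha>" using c by (simp add: powr_mult)
        also have "\<dots> \<le> 4 powr 1 * c powr \<alpha>" using \<alpha> by (intro mult_right_mono powr_mono) auto
        finally show ?thesis by simp
      qed
      ultimately have "C * sqrt (real (Suc (k + n))) * (block_mesh k n / b * b powr \<alpha>)
          \<le> C * (sqrt (real (Suc k)) * sqrt (real (Suc n))) * (3 / 2 ^ n * (4 * c powr \<alpha>))"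
        using \<open>0 \<le> C\<close> \<open>0 < b\<close> block_mesh_pos[of k n]
        by (intro mult_mono mult_nonneg_nonneg) (auto intro: less_imp_le)
      also have "\<dots> = 12 * C * sqrt (real (Suc k)) * c powr \<alpha> * q ^ n * (sqrt (real (Suc n)) * (1 / 2 / q) ^ n)"
        using q by (simp add: power_divide field_simps)
      also have "\<dots> \<le> 12 * C * sqrt (real (Suc k)) * c powr \<alpha> * q ^ n * M"
        using \<open>0 \<le> C\<close> q M(2)[of n] by (intro mult_left_mono) auto
      also have "\<dots> = B * (2 powr - \<alpha>) ^ n" by (simp add: B_def q_def)
      finally have "\<bar>f (block_point k n (Suc j)) - f b\<bar> \<le> B * (2 powr - \<alpha>) ^ n"
        using inc[OF j, of k] by (simp add: b_def)
      moreover have "g (real i / 2 ^ n) = f (block_point k n i)" for i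
        by (simp add: g_def block_point_def c_def)
      ultimately show ?thesis by (simp add: b_def del: of_nat_Suc)
    qed
    note holder = dyadic_increments_imp_holder[OF cont_g \<alpha>(1) \<open>0 \<le> B\<close> this]
    \<comment> \<open>The coordinates of \<open>s\<close> and \<open>s + h\<close> in the block rescaled to \<open>[0, 1]\<close>.\<close>
    define x y where "x = (s / c - 1) / 3" and "y = ((s + h) / c - 1) / 3"
    have "\<bar>g y - g x\<bar> \<le> 2 powr \<alpha> * (1 + 2 / (1 - 2 powr - \<alpha>)) * B * (y - x) powr \<alpha>"
      by (rule holder) (use c h in \<open>auto simp: x_def y_def field_simps\<close>)
    moreover have "c * (1 + 3 * x) = s" "c * (1 + 3 * y) = s + h" using c by (simp_all add: x_def y_def field_simps)
    then have "g x = f s" "g y = f (s + h)" by (simp_all only: g_def)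
    ultimately have "\<bar>f (s + h) - f s\<bar> \<le> A * B * (y - x) powr \<alpha>" by (simp add: A_def q_def)
    also have "\<dots> \<le> A * B * (h / c) powr \<alpha>"
      using \<open>0 \<le> A\<close> \<open>0 \<le> B\<close> c h \<alpha>
      by (intro mult_left_mono powr_mono2) (auto simp: x_def y_def field_simps)
    also have "\<dots> = A * 12 * C * M * sqrt (real (Suc k)) * h powr \<alpha>"
      using c h by (simp add: B_def powr_divide)
    finally show ?thesis .
  qed
  define D where "D = 2 * C + 2 * (A * 12 * C * M)"
  have D: "2 * C \<le> D" "2 * (A * 12 * C * M) \<le> D" "0 \<le> D"
    using \<open>0 \<le> A\<close> \<open>0 \<le> C\<close> M by (auto simp: D_def)
  show thesis
  proof (rule that[OF D(3)])
    fix s h :: real assume s: "0 < s" "s \<le> 1" and h: "0 \<le> h" "h \<le> s"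
    obtain k where k: "1 / 2 ^ Suc k < s" "s \<le> 1 / 2 ^ k" using dyadic_scale[OF s] .
    have "\<bar>f (s + h) - f s\<bar> \<le> (A * 12 * C * M) * h powr \<alpha> * sqrt (real (Suc k))"
      using block[of k s h] k h by (simp add: mult_ac)
    also have "\<dots> \<le> (A * 12 * C * M) * h powr \<alpha> * (2 * log_weight s)"
      using \<open>0 \<le> A\<close> \<open>0 \<le> C\<close> M s k by (intro mult_left_mono sqrt_level_le_log_weight) auto
    also have "\<dots> = 2 * (A * 12 * C * M) * (h powr \<alpha> * log_weight s)" by simp
    also have "\<dots> \<le> D * (h powr \<alpha> * log_weight s)"
      using D log_weight_nonneg[OF s] by (intro mult_right_mono) auto
    finally show "\<bar>f (s + h) - f s\<bar> \<le> D * h powr \<alpha> * log_weight s" by (simp add: mult.assoc)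
  next
    fix s :: real assume s: "0 < s" "s \<le> 1"
    obtain k where k: "1 / 2 ^ Suc k < s" "s \<le> 1 / 2 ^ k" using dyadic_scale[OF s] .
    define c where "c = (1::real) / 2 ^ Suc k"
    have c: "0 < c" "c < s" "s \<le> 2 * c" using k by (auto simp: c_def)
    \<comment> \<open>The value at \<open>s\<close> is reached from the lower end point of the block by one increment.\<close>
    have "\<bar>f (c + (s - c)) - f c\<bar> \<le> A * 12 * C * M * sqrt (real (Suc k)) * (s - c) powr \<alpha>"
      using c by (intro block) (auto simp: c_def)
    also have "\<dots> \<le> A * 12 * C * M * sqrt (real (Suc k)) * s powr \<alpha>"
      using \<open>0 \<le> A\<close> \<open>0 \<le> C\<close> M c \<alpha> by (intro mult_left_mono powr_mono2) auto
    finally have "\<bar>f s - f c\<bar> \<le> A * 12 * C * M * sqrt (real (Suc k)) * s powr \<alpha>" by simp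
    moreover have "\<bar>f c\<bar> \<le> C * sqrt (real (Suc k)) * s powr \<alpha>"
    proof -
      have "\<bar>f c\<bar> \<le> C * sqrt (real (Suc k)) * c powr \<alpha>" unfolding c_def by (rule point)
      also have "\<dots> \<le> C * sqrt (real (Suc k)) * s powr \<alpha>"
        using \<open>0 \<le> C\<close> c \<alpha> by (intro mult_left_mono powr_mono2) auto
      finally show ?thesis .
    qed
    ultimately have "\<bar>f s\<bar> \<le> (C + A * 12 * C * M) * s powr \<alpha> * sqrt (real (Suc k))"
      by (simp add: algebra_simps)
    also have "\<dots> \<le> (C + A * 12 * C * M) * s powr \<alpha> * (2 * log_weight s)"
      using \<open>0 \<le> A\<close> \<open>0 \<le> C\<close> M s k by (intro mult_left_mono sqrt_level_le_log_weight) auto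
    also have "\<dots> = D * s powr \<alpha> * log_weight s" by (simp add: D_def algebra_simps)
    finally show "\<bar>f s\<bar> \<le> D * s powr \<alpha> * log_weight s" .
  qed
qed

text \<open>If \<open>h > s\<close>, both end points lie in \<open>(0, 2h]\<close>, so the two values themselves are of order \<open>h\<^sup>\<alpha>\<close> times a
  logarithmic weight, and the weight is largest at the left end point \<open>s\<close>.\<close>

lemma log_modulus_all_increments:
  fixes f :: "real \<Rightarrow> real"
  assumes \<alpha>: "0 < \<alpha>" "\<alpha> < 1" and "0 \<le> D"
    and point: "\<And>s. 0 < s \<Longrightarrow> s \<le> 1 \<Longrightarrow> \<bar>f s\<bar> \<le> D * s powr \<alpha> * log_weight s"
    and inc: "\<And>s h. 0 < s \<Longrightarrow> s \<le> 1 \<Longrightarrow> 0 \<le> h \<Longrightarrow> h \<le> s \<Longrightarrow> \<bar>f (s + h) - f s\<bar> \<le> D * h powr \<alpha> * log_weight s"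
    and s: "0 < s" "0 \<le> h" "s + h \<le> 1"
  shows "\<bar>f (s + h) - f s\<bar> \<le> 3 * D * h powr \<alpha> * log_weight s"
proof -
  define w where "w = D * h powr \<alpha> * log_weight s"
  have w: "0 \<le> w" using \<open>0 \<le> D\<close> s log_weight_nonneg[of s] by (simp add: w_def)
  have "\<bar>f (s + h) - f s\<bar> \<le> 3 * w"
  proof (cases "h \<le> s")
    case True
    then show ?thesis using inc[of s h] s w by (simp add: w_def)
  next
    case False
    have "\<bar>f s\<bar> \<le> D * s powr \<alpha> * log_weight s" using point[of s] s by simp
    also have "\<dots> \<le> w"
      unfolding w_def using False s \<alpha> \<open>0 \<le> D\<close> log_weight_nonneg[of s]
      by (intro mult_right_mono mult_left_mono powr_mono2) auto
    finally have "\<bar>f s\<bar> \<le> w" .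
    moreover have "\<bar>f (s + h)\<bar> \<le> 2 * w"
    proof -
      have "(s + h) powr \<alpha> \<le> (2 * h) powr \<alpha>" using False s \<alpha> by (intro powr_mono2) auto
      also have "\<dots> = 2 powr \<alpha> * h powr \<alpha>" using s by (simp add: powr_mult)
      also have "\<dots> \<le> 2 powr 1 * h powr \<alpha>" using \<alpha> by (intro mult_right_mono powr_mono) auto
      finally have "D * (s + h) powr \<alpha> * log_weight (s + h) \<le> D * (2 * h powr \<alpha>) * log_weight s"
        using \<open>0 \<le> D\<close> s log_weight_nonneg[of "s + h"]
        by (intro mult_mono log_weight_antimono mult_left_mono) auto
      then show ?thesis using point[of "s + h"] s by (simp add: w_def)
    qed
    ultimately show ?thesis by linarith
  qed
  then show ?thesis by (simp add: w_def)
qed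


section \<open>Orlicz norm of the logarithmic weight\<close>

text \<open>From \<open>1 + y \<le> e\<^sup>y\<close> at \<open>y = ln (1/u) / p\<close>. The exponent \<open>1/p\<close> is chosen so that, after raising to the power \<open>p/2\<close>,
  the singularity at \<open>0\<close> is integrable independently of \<open>p\<close>.\<close>

lemma log_weight_powr_le:
  assumes u: "0 < u" "u \<le> 1" and p: "1 \<le> p"
  shows "log_weight u powr p \<le> p powr (p / 2) * u powr (- 1 / 2)"
proof -
  have ln_nonneg: "0 \<le> ln (1 / u)" using u by simp
  have "1 + ln (1 / u) \<le> p * (1 + ln (1 / u) / p)"
    using p by (simp add: distrib_left)
  also have "\<dots> \<le> p * exp (ln (1 / u) / p)"
    using p by (intro mult_left_mono exp_ge_add_one_self) auto
  also have "exp (ln (1 / u) / p) = u powr (- 1 / p)"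
    using u by (simp add: powr_def ln_div)
  finally have le: "1 + ln (1 / u) \<le> p * u powr (- 1 / p)" .
  have "log_weight u powr p = (1 + ln (1 / u)) powr (p / 2)"
    using ln_nonneg by (simp add: log_weight_def powr_half_sqrt[symmetric] powr_powr)
  also have "\<dots> \<le> (p * u powr (- 1 / p)) powr (p / 2)"
    using le ln_nonneg p by (intro powr_mono2) auto
  also have "\<dots> = p powr (p / 2) * u powr (- 1 / 2)"
    using p by (simp add: powr_mult powr_powr)
  finally show ?thesis .
qed

lemma nn_integral_inverse_sqrt:
  "(\<integral>\<^sup>+u\<in>{0..1}. ennreal (u powr (- 1 / 2)) \<partial>lborel) = 2"
proof -
  have "((\<lambda>u::real. u powr (- 1 / 2)) has_integral 2) {0..1}"
    using has_integral_powr_from_0[of "- 1 / 2" 1] by simp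
  from nn_integral_has_integral_lebesgue'[OF _ this] show ?thesis by simp
qed

text \<open>The shift \<open>a\<close> allows the singularity of the weight to sit at either end of an increment, as needed for
  increments with negative \<open>h\<close>.\<close>

lemma orlicz_norm_log_weight:
  assumes "0 \<le> B" and f: "\<And>x. x \<in> J \<Longrightarrow> 0 < x + a \<and> x + a \<le> 1 \<and> \<bar>f x\<bar> \<le> B * log_weight (x + a)"
  shows "orlicz_norm_on J f \<le> ennreal (2 * B)"
  unfolding orlicz_norm_on_def
proof (rule SUP_least)
  fix p :: real assume "p \<in> {1..}"
  then have p: "1 \<le> p" by simp
  define Q where "Q = B powr p * p powr (p / 2)"
  have "0 \<le> Q" by (simp add: Q_def)
  define S where "S = (\<integral>\<^sup>+x\<in>J. ennreal (\<bar>f x\<bar> powr p) \<partial>lebesgue)"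
  have "S \<le> (\<integral>\<^sup>+x. ennreal Q * (ennreal ((a + 1 * x) powr (- 1 / 2)) * indicator {0..1} (a + 1 * x)) \<partial>lebesgue)"
    unfolding S_def
  proof (rule nn_integral_mono)
    fix x :: real
    have "\<bar>f x\<bar> powr p \<le> Q * (x + a) powr (- 1 / 2)" if "x \<in> J"
    proof -
      have u: "0 < x + a" "x + a \<le> 1" "\<bar>f x\<bar> \<le> B * log_weight (x + a)" using f[OF that] by auto
      have "\<bar>f x\<bar> powr p \<le> (B * log_weight (x + a)) powr p"
        using u p by (intro powr_mono2) auto
      also have "\<dots> = B powr p * log_weight (x + a) powr p"
        using \<open>0 \<le> B\<close> log_weight_nonneg[OF u(1,2)] by (simp add: powr_mult)
      also have "\<dots> \<le> B powr p * (p powr (p / 2) * (x + a) powr (- 1 / 2))"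
        by (intro mult_left_mono log_weight_powr_le u p) auto
      finally show ?thesis by (simp add: Q_def mult.assoc)
    qed
    then show "ennreal (\<bar>f x\<bar> powr p) * indicator J x
        \<le> ennreal Q * (ennreal ((a + 1 * x) powr (- 1 / 2)) * indicator {0..1} (a + 1 * x))"
      using f[of x] \<open>0 \<le> Q\<close>
      by (auto simp: indicator_def add.commute[of a] ennreal_leI less_imp_le simp flip: ennreal_mult)
  qed
  also have "\<dots> = ennreal Q * (\<integral>\<^sup>+x. ennreal ((a + 1 * x) powr (- 1 / 2)) * indicator {0..1} (a + 1 * x) \<partial>lborel)"
    unfolding nn_integral_completion by (rule nn_integral_cmult) measurable
  also have "(\<integral>\<^sup>+x. ennreal ((a + 1 * x) powr (- 1 / 2)) * indicator {0..1} (a + 1 * x) \<partial>lborel)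
      = (\<integral>\<^sup>+u\<in>{0..1}. ennreal (u powr (- 1 / 2)) \<partial>lborel)"
    by (subst nn_integral_real_affine[where c = 1 and t = a]) auto
  also have "ennreal Q * \<dots> = ennreal (2 * Q)"
    unfolding nn_integral_inverse_sqrt using \<open>0 \<le> Q\<close> by (simp add: ennreal_mult mult.commute)
  finally have S: "S \<le> ennreal (2 * Q)" .
  then have "S < \<infinity>" by (rule order.strict_trans1) simp
  have "enn2real S \<le> 2 * Q" using S \<open>0 \<le> Q\<close> by (intro enn2real_leI) auto
  then have "enn2real S powr (1 / p) \<le> (2 * Q) powr (1 / p)"
    using p by (intro powr_mono2) auto
  also have "\<dots> = 2 powr (1 / p) * B * p powr (1 / 2)"
    using p \<open>0 \<le> B\<close> by (simp add: Q_def powr_mult powr_powr)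
  also have "\<dots> \<le> 2 powr 1 * B * p powr (1 / 2)"
    using p \<open>0 \<le> B\<close> by (intro mult_right_mono powr_mono) auto
  finally have "p powr (- 1 / 2) * enn2real S powr (1 / p) \<le> p powr (- 1 / 2) * (2 * B * p powr (1 / 2))"
    by (intro mult_left_mono) auto
  also have "\<dots> = 2 * B * (p powr (- 1 / 2) * p powr (1 / 2))" by simp
  also have "p powr (- 1 / 2) * p powr (1 / 2) = 1"
    unfolding powr_add[symmetric] using p by simp
  finally have "ennreal (p powr (- 1 / 2) * enn2real S powr (1 / p)) \<le> ennreal (2 * B)"
    by (intro ennreal_leI) simp
  then show "ennreal (p powr (- 1 / 2)) * Lp_norm_on p J f \<le> ennreal (2 * B)"
    using \<open>S < \<infinity>\<close> by (auto simp: Lp_norm_on_def S_def[symmetric] ennreal_mult)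
qed

lemma log_modulus_imp_besov_orlicz:
  fixes f :: "real \<Rightarrow> real"
  assumes cont: "continuous_on {0..} f" and \<alpha>: "0 < \<alpha>" and "0 \<le> D"
    and point: "\<And>s. 0 < s \<Longrightarrow> s \<le> 1 \<Longrightarrow> \<bar>f s\<bar> \<le> D * s powr \<alpha> * log_weight s"
    and inc: "\<And>s h. 0 < s \<Longrightarrow> 0 \<le> h \<Longrightarrow> s + h \<le> 1 \<Longrightarrow> \<bar>f (s + h) - f s\<bar> \<le> D * h powr \<alpha> * log_weight s"
  shows "f \<in> besov_orlicz \<alpha>"
proof -
  have "continuous_on unit_I f"
    by (rule continuous_on_subset[OF cont]) (auto simp: unit_I_def)
  then have meas: "f \<in> borel_measurable (lebesgue_on unit_I)"
    by (rule continuous_imp_measurable_on_sets_lebesgue) (simp add: unit_I_def)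
  have "orlicz_norm_on unit_I f \<le> ennreal (2 * D)"
  proof (rule orlicz_norm_log_weight[where a = 0, OF \<open>0 \<le> D\<close>])
    fix x assume "x \<in> unit_I"
    then have x: "0 < x" "x \<le> 1" by (auto simp: unit_I_def)
    have "x powr \<alpha> \<le> 1" using x \<alpha> by (simp add: powr_le1)
    then have "D * x powr \<alpha> * log_weight x \<le> D * 1 * log_weight x"
      using \<open>0 \<le> D\<close> log_weight_nonneg[OF x] by (intro mult_right_mono mult_left_mono) auto
    then show "0 < x + 0 \<and> x + 0 \<le> 1 \<and> \<bar>f x\<bar> \<le> D * log_weight (x + 0)"
      using point[OF x] x by simp
  qed
  then have orlicz: "orlicz_norm_on unit_I f < \<infinity>" by (rule order.strict_trans1) simp
  \<comment> \<open>The weight belongs at the left one of the points \<open>s\<close>, \<open>s + h\<close>, that is at \<open>s + min 0 h\<close>.\<close>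
  have shift: "orlicz_norm_on (shift_I h) (\<lambda>s. f (s + h) - f s) \<le> ennreal (2 * (D * \<bar>h\<bar> powr \<alpha>))" for h
  proof (rule orlicz_norm_log_weight[where a = "min 0 h"])
    show "0 \<le> D * \<bar>h\<bar> powr \<alpha>" using \<open>0 \<le> D\<close> by simp
    fix s assume "s \<in> shift_I h"
    then have s: "0 < s" "s < 1" "0 < s + h" "s + h < 1" by (auto simp: shift_I_def unit_I_def)
    show "0 < s + min 0 h \<and> s + min 0 h \<le> 1 \<and>
        \<bar>f (s + h) - f s\<bar> \<le> D * \<bar>h\<bar> powr \<alpha> * log_weight (s + min 0 h)"
    proof (cases "0 \<le> h")
      case True
      then show ?thesis using s inc[of s h] by simp
    next
      case False
      then show ?thesis using s inc[of "s + h" "- h"] by (simp add: abs_minus_commute)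
    qed
  qed
  have "besov_orlicz_seminorm \<alpha> f \<le> ennreal (2 * D)"
    unfolding besov_orlicz_seminorm_def
  proof (rule SUP_least)
    fix t :: real assume "t \<in> {0<..1}"
    then have t: "0 < t" by simp
    have "(SUP h\<in>{h. \<bar>h\<bar> \<le> t}. orlicz_norm_on (shift_I h) (\<lambda>s. f (s + h) - f s)) \<le> ennreal (2 * (D * t powr \<alpha>))"
    proof (rule SUP_least)
      fix h :: real assume "h \<in> {h. \<bar>h\<bar> \<le> t}"
      then have "2 * (D * \<bar>h\<bar> powr \<alpha>) \<le> 2 * (D * t powr \<alpha>)"
        using \<open>0 \<le> D\<close> \<alpha> by (intro mult_left_mono powr_mono2) auto
      then show "orlicz_norm_on (shift_I h) (\<lambda>s. f (s + h) - f s) \<le> ennreal (2 * (D * t powr \<alpha>))"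
        using order.trans[OF shift ennreal_leI] by blast
    qed
    then have "ennreal (t powr - \<alpha>) * (SUP h\<in>{h. \<bar>h\<bar> \<le> t}. orlicz_norm_on (shift_I h) (\<lambda>s. f (s + h) - f s))
        \<le> ennreal (t powr - \<alpha>) * ennreal (2 * (D * t powr \<alpha>))"
      by (rule mult_left_mono) simp
    also have "\<dots> = ennreal (2 * D)"
      using t \<open>0 \<le> D\<close> by (simp add: powr_minus field_simps flip: ennreal_mult)
    finally show "ennreal (t powr - \<alpha>) * (SUP h\<in>{h. \<bar>h\<bar> \<le> t}. orlicz_norm_on (shift_I h) (\<lambda>s. f (s + h) - f s))
        \<le> ennreal (2 * D)" .
  qed
  then have "besov_orlicz_seminorm \<alpha> f < \<infinity>" by (rule order.strict_trans1) simp
  with meas orlicz show ?thesis by (simp add: besov_orlicz_def)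
qed


section \<open>Paths of the process\<close>

theorem theorem3p3:
  fixes M :: "'a measure"
    and W X :: "real \<Rightarrow> 'a \<Rightarrow> real"
    and H K :: real
  assumes "0 < H" "H < 1" "0 < K" "K < 2" "0 < H * K" "H * K < 1"
    and "standard_brownian_motion M W"
    and "continuous_version_XHK M W H K X"
  shows "AE \<omega> in M. (\<lambda>t. X t \<omega>) \<in> besov_orlicz (H * K)"
proof -
  define \<alpha> where "\<alpha> = H * K"
  have \<alpha>: "0 < \<alpha>" "\<alpha> < 1" using assms by (auto simp: \<alpha>_def)
  have M: "prob_space M" using assms by (simp add: standard_brownian_motion_def)
  have X: "is_wiener_integral M W (XHK_kernel H K t) (X t)" if "0 < t" for t
    using assms that by (simp add: continuous_version_XHK_def)
  then have X_meas: "X t \<in> borel_measurable M" if "0 < t" for t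
    using that by (simp add: is_wiener_integral_def)
  have cont: "AE \<omega> in M. continuous_on {0..} (\<lambda>t. X t \<omega>)"
    using assms by (simp add: continuous_version_XHK_def)
  obtain b where b: "0 < b"
    and point_tail: "\<And>s r. 0 < s \<Longrightarrow> 0 < r \<Longrightarrow>
      emeasure M {\<omega> \<in> space M. r \<le> \<bar>X s \<omega> / s powr \<alpha>\<bar>} \<le> ennreal (2 * exp (- (r\<^sup>2 / b)))"
    and inc_tail: "\<And>s h r. 0 < s \<Longrightarrow> 0 < h \<Longrightarrow> h \<le> 3 * s \<Longrightarrow> 0 < r \<Longrightarrow>
      emeasure M {\<omega> \<in> space M. r \<le> \<bar>(X (s + h) \<omega> - X s \<omega>) / (h / s * s powr \<alpha>)\<bar>}
        \<le> ennreal (2 * exp (- (r\<^sup>2 / b)))"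
    by (rule XHK_tails[OF assms(1,2,7) X, folded \<alpha>_def], assumption) (rule that; blast)
  \<comment> \<open>Normalised values at the lower end points of the blocks, one for each level.\<close>
  define \<xi> where "\<xi> m i \<omega> = X (1 / 2 ^ Suc m) \<omega> / (1 / 2 ^ Suc m) powr \<alpha>" for m and i :: unit and \<omega>
  have points: "AE \<omega> in M. \<exists>C\<ge>0. \<forall>m. \<forall>i\<in>{()}. \<bar>\<xi> m i \<omega>\<bar> \<le> C * sqrt (real (Suc m))"
  proof (rule AE_log_bound_of_subgaussian_families[OF M _ _ _ _ b])
    show "card {()} \<le> 8 ^ Suc m" for m by simp
    show "\<xi> m i \<in> borel_measurable M" for m i
      unfolding \<xi>_def using X_meas[of "1 / 2 ^ Suc m"] by (intro borel_measurable_divide) auto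
    show "emeasure M {\<omega> \<in> space M. r \<le> \<bar>\<xi> m i \<omega>\<bar>} \<le> ennreal (2 * exp (- (r\<^sup>2 / b)))"
      if "0 < r" for m i r
      unfolding \<xi>_def by (rule point_tail) (use that in auto)
  qed simp
  \<comment> \<open>The dyadic increments are grouped by \<open>k + n\<close>, which bounds both the block index and the level, so that each group is finite.\<close>
  define I where "I m = {(k, n, j). k + n = m \<and> j < (2::nat) ^ n}" for m :: nat
  have I_sub: "I m \<subseteq> {..m} \<times> {..m} \<times> {..<2 ^ m}" for m
  proof
    fix x assume "x \<in> I m"
    then obtain k n j where x: "x = (k, n, j)" "k + n = m" "j < 2 ^ n" by (auto simp: I_def)
    moreover have "(2::nat) ^ n \<le> 2 ^ m" using x by (intro power_increasing) auto
    then have "j < 2 ^ m" using x(3) by linarith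
    ultimately show "x \<in> {..m} \<times> {..m} \<times> {..<2 ^ m}" by auto
  qed
  define \<eta> where "\<eta> m i \<omega> = (case i of (k, n, j) \<Rightarrow>
      (X (block_point k n j + block_mesh k n) \<omega> - X (block_point k n j) \<omega>)
      / (block_mesh k n / block_point k n j * block_point k n j powr \<alpha>))" for m :: nat and i \<omega>
  have incs: "AE \<omega> in M. \<exists>C\<ge>0. \<forall>m. \<forall>i\<in>I m. \<bar>\<eta> m i \<omega>\<bar> \<le> C * sqrt (real (Suc m))"
  proof (rule AE_log_bound_of_subgaussian_families[OF M _ _ _ _ b])
    show "finite (I m)" for m by (rule finite_subset[OF I_sub]) simp
    show "card (I m) \<le> 8 ^ Suc m" for m
    proof -
      have "card (I m) \<le> card ({..m} \<times> {..m} \<times> {..<(2::nat) ^ m})"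
        by (rule card_mono[OF _ I_sub]) simp
      also have "\<dots> = Suc m * (Suc m * 2 ^ m)" by (simp add: card_cartesian_product)
      also have "\<dots> \<le> 2 ^ Suc m * (2 ^ Suc m * 2 ^ Suc m)"
        using less_exp[of "Suc m"] by (intro mult_le_mono power_increasing) auto
      also have "\<dots> = 8 ^ Suc m" by (simp only: power_mult_distrib[symmetric]) simp
      finally show ?thesis .
    qed
    show "\<eta> m i \<in> borel_measurable M" for m i
    proof (cases i)
      case (fields k n j)
      then show ?thesis
        unfolding \<eta>_def using X_meas block_point_pos[of k n j] block_mesh_pos[of k n]
        by (auto intro!: borel_measurable_divide borel_measurable_diff add_pos_pos)
    qed
    show "emeasure M {\<omega> \<in> space M. r \<le> \<bar>\<eta> m i \<omega>\<bar>} \<le> ennreal (2 * exp (- (r\<^sup>2 / b)))"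
      if "0 < r" for m i r
      by (cases i) (use inc_tail[OF block_point_pos block_mesh_pos block_mesh_le3 that] in \<open>simp add: \<eta>_def\<close>)
  qed
  from points incs cont show ?thesis
  proof eventually_elim
    case (elim \<omega>)
    obtain C1 where C1: "0 \<le> C1" "\<And>m. \<bar>\<xi> m () \<omega>\<bar> \<le> C1 * sqrt (real (Suc m))" using elim(1) by auto
    obtain C2 where C2: "0 \<le> C2" "\<And>m i. i \<in> I m \<Longrightarrow> \<bar>\<eta> m i \<omega>\<bar> \<le> C2 * sqrt (real (Suc m))" using elim(2) by auto
    define f where "f t = X t \<omega>" for t
    have point: "\<bar>f (1 / 2 ^ Suc k)\<bar> \<le> (C1 + C2) * sqrt (real (Suc k)) * (1 / 2 ^ Suc k) powr \<alpha>" for k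
    proof -
      have "\<bar>f (1 / 2 ^ Suc k)\<bar> \<le> C1 * sqrt (real (Suc k)) * (1 / 2 ^ Suc k) powr \<alpha>"
        using C1(2)[of k] unfolding \<xi>_def f_def abs_divide by (subst (asm) pos_divide_le_eq) auto
      also have "\<dots> \<le> (C1 + C2) * sqrt (real (Suc k)) * (1 / 2 ^ Suc k) powr \<alpha>"
        using C2(1) by (intro mult_right_mono) auto
      finally show ?thesis .
    qed
    have inc: "\<bar>f (block_point k n (Suc j)) - f (block_point k n j)\<bar>
      \<le> (C1 + C2) * sqrt (real (Suc (k + n))) * (block_mesh k n / block_point k n j * block_point k n j powr \<alpha>)"
      if "j < 2 ^ n" for k n j
    proof -
      define w where "w = block_mesh k n / block_point k n j * block_point k n j powr \<alpha>"
      have "0 < w" unfolding w_def using block_point_pos[of k n j] block_mesh_pos[of k n] by simp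
      have "\<bar>(f (block_point k n (Suc j)) - f (block_point k n j)) / w\<bar> \<le> C2 * sqrt (real (Suc (k + n)))"
        using C2(2)[of "(k, n, j)" "k + n"] that by (simp add: I_def \<eta>_def f_def w_def block_point_Suc)
      then have "\<bar>f (block_point k n (Suc j)) - f (block_point k n j)\<bar> \<le> C2 * sqrt (real (Suc (k + n))) * w"
        using \<open>0 < w\<close> by (simp add: abs_divide pos_divide_le_eq)
      also have "\<dots> \<le> (C1 + C2) * sqrt (real (Suc (k + n))) * w"
        using C1(1) \<open>0 < w\<close> by (intro mult_right_mono) auto
      finally show ?thesis by (simp add: w_def)
    qed
    have "continuous_on {0..} f" using elim(3) by (simp add: f_def[abs_def])
    obtain D where D: "0 \<le> D"
      "\<And>s. 0 < s \<Longrightarrow> s \<le> 1 \<Longrightarrow> \<bar>f s\<bar> \<le> D * s powr \<alpha> * log_weight s"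
      "\<And>s h. 0 < s \<Longrightarrow> s \<le> 1 \<Longrightarrow> 0 \<le> h \<Longrightarrow> h \<le> s \<Longrightarrow> \<bar>f (s + h) - f s\<bar> \<le> D * h powr \<alpha> * log_weight s"
      using dyadic_bounds_imp_log_modulus[OF \<open>continuous_on {0..} f\<close> \<alpha> add_nonneg_nonneg[OF C1(1) C2(1)] point inc]
      by blast
    have "f \<in> besov_orlicz \<alpha>"
    proof (rule log_modulus_imp_besov_orlicz[OF \<open>continuous_on {0..} f\<close> \<alpha>(1), of "3 * D"])
      show "\<bar>f s\<bar> \<le> 3 * D * s powr \<alpha> * log_weight s" if "0 < s" "s \<le> 1" for s
      proof -
        have "0 \<le> D * s powr \<alpha> * log_weight s" using D(1) log_weight_nonneg[OF that] by simp
        then show ?thesis using D(2)[OF that] by simp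
      qed
      show "\<bar>f (s + h) - f s\<bar> \<le> 3 * D * h powr \<alpha> * log_weight s" if "0 < s" "0 \<le> h" "s + h \<le> 1" for s h
        by (rule log_modulus_all_increments[OF \<alpha> D(1) D(2) D(3) that])
    qed (use D(1) in simp)
    then show ?case by (simp add: f_def[abs_def] \<alpha>_def)
  qed
qed


end
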